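(* Let $d\in\mathbb{N}$, let $p$ be a kernel on $\mathbb{Z}^d$ as in the context, and let $\xi=\{\xi_t(x)\}_{t\in\mathbb{Z},x\in\mathbb{Z}^d}$ be i.i.d. real random variables with mean zero and variance $\sigma_\xi^2<\infty$, with law $\mathbb{P}$. For $x,y\in\mathbb{Z}^d$, $t\in\mathbb{Z}$ define \[\Delta_t(x,y)=\sum_{k=0}^\infty\sum_{z\in\mathbb{Z}^d}\xi_{t-k}(z)\bigl(p^k(y,z)-p^k(x,z)\bigr).\] Then this series converges for $\mathbb{P}$-almost every $\xi$ and in $L^2(\mathbb{P})$. For almost every $\xi$, the variables satisfy the additivity $\Delta_t(x,y)+\Delta_t(y,z)=\Delta_t(x,z)$ for all $x,y,z$ and the evolution equation \[\Delta_{t+1}(x,y)=\sum_z p(0,z)\Delta_t(x+z,y+z)+\xi_{t+1}(y)-\xi_{t+1}(x),\quad x,y\in\mathbb{Z}^d,\ t\in\mathbb{Z}.\] Setting $\Delta_t(x)=(\Delta_t(x-e_i,x))_{i=1}^d\in\mathbb{R}^d$ and $\Delta_t=\{\Delta_t(x)\}_{x\in\mathbb{Z}^d}$, the process $\{\Delta_t\}_{t\in\mathbb{Z}}$ is a stationary version of the Markov chain on $(\mathbb{R}^d)^{\mathbb{Z}^d}$ given by \[\eta_{t+1}(x-e_i,x)=\sum_z p(0,z)\eta_t(x+z-e_i,x+z)+\xi_{t+1}(x)-\xi_{t+1}(x-e_i),\quad x\in\mathbb{Z}^d,\ i=1,\dots,d,\] and the random field $\{\Delta_t(x)\}_{t\in\mathbb{Z},x\in\mathbb{Z}^d}$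 is invariant and ergodic under each individual space-time shift $\theta_{x,t}$ with $(x,t)\ne(0,0)$.
   Context: The kernel $p:\mathbb{Z}^d\to[0,1)$ satisfies $\sum_x p(x)=1$, $p(x)=0$ for $|x|>M$ for some $M<\infty$, and strong aperiodicity: for every $u\in\mathbb{Z}^d$ the smallest additive subgroup of $\mathbb{Z}^d$ containing $\{u+x:p(x)>0\}$ is $\mathbb{Z}^d$. $p(x,y)=p(y-x)$, $p^0(x,y)=\mathbf{1}_{x=y}$ and $p^k$ is the $k$-step transition probability. $e_i$ are the standard unit vectors. The space-time shift $\theta_{x,t}$ acts on space-time indexed fields by $(\theta_{x,t}\omega)_s(y)=\omega_{s+t}(y+x)$; in the Markov chain, $\xi_{t+1}=\{\xi_{t+1}(x)\}_x$ is independent of $\eta_t$. *)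

theory Defs
  imports "HOL-Probability.Probability"
begin

definition add_subgroup :: "'a::ab_group_add set \<Rightarrow> bool" where
  "add_subgroup H \<longleftrightarrow> 0 \<in> H \<and> (\<forall>a\<in>H. \<forall>b\<in>H. a + b \<in> H) \<and> (\<forall>a\<in>H. - a \<in> H)"

definition gen_add_subgroup :: "'a::ab_group_add set \<Rightarrow> 'a set" where
  "gen_add_subgroup S = \<Inter>{H. add_subgroup H \<and> S \<subseteq> H}"

definition strongly_aperiodic :: "(int^'d \<Rightarrow> real) \<Rightarrow> bool" where
  "strongly_aperiodic p \<longleftrightarrow>
     (\<forall>u. gen_add_subgroup {u + x | x. p x > 0} = UNIV)"

text \<open>k-step transition probability p^k(x,y), with p(x,y) = p(y - x).\<close>
primrec trans_pow :: "(int^'d \<Rightarrow> real) \<Rightarrow> nat \<Rightarrow> int^'d \<Rightarrow> int^'d \<Rightarrow> real" where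
  "trans_pow p 0 x y = (if x = y then 1 else 0)"
| "trans_pow p (Suc k) x y = (\<Sum>\<^sub>\<infinity>z. p (z - x) * trans_pow p k z y)"

definition Delta_partial ::
  "(int^'d \<Rightarrow> real) \<Rightarrow> (int \<Rightarrow> int^'d \<Rightarrow> 'w \<Rightarrow> real) \<Rightarrow> nat \<Rightarrow> int \<Rightarrow> int^'d \<Rightarrow> int^'d \<Rightarrow> 'w \<Rightarrow> real" where
  "Delta_partial p \<xi> n t x y \<omega> =
     (\<Sum>k<n. \<Sum>\<^sub>\<infinity>z. \<xi> (t - int k) z \<omega> * (trans_pow p k y z - trans_pow p k x z))"

definition Delta ::
  "(int^'d \<Rightarrow> real) \<Rightarrow> (int \<Rightarrow> int^'d \<Rightarrow> 'w \<Rightarrow> real) \<Rightarrow> int \<Rightarrow> int^'d \<Rightarrow> int^'d \<Rightarrow> 'w \<Rightarrow> real" where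
  "Delta p \<xi> t x y \<omega> = lim (\<lambda>n. Delta_partial p \<xi> n t x y \<omega>)"

definition Delta_vec ::
  "(int^'d \<Rightarrow> real) \<Rightarrow> (int \<Rightarrow> int^'d \<Rightarrow> 'w \<Rightarrow> real) \<Rightarrow> int \<Rightarrow> int^'d \<Rightarrow> 'w \<Rightarrow> real^'d" where
  "Delta_vec p \<xi> t x \<omega> = (\<chi> i. Delta p \<xi> t (x - axis i 1) x \<omega>)"

definition st_shift :: "int^'d \<Rightarrow> int \<Rightarrow> (int \<times> (int^'d) \<Rightarrow> 'a) \<Rightarrow> (int \<times> (int^'d) \<Rightarrow> 'a)" where
  "st_shift x t f = (\<lambda>(s, y). f (s + t, y + x))"

definition invariant_under :: "'a measure \<Rightarrow> ('a \<Rightarrow> 'a) \<Rightarrow> bool" where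
  "invariant_under \<mu> T \<longleftrightarrow> T \<in> measurable \<mu> \<mu> \<and> distr \<mu> \<mu> T = \<mu>"

definition ergodic_under :: "'a measure \<Rightarrow> ('a \<Rightarrow> 'a) \<Rightarrow> bool" where
  "ergodic_under \<mu> T \<longleftrightarrow> T \<in> measurable \<mu> \<mu> \<and>
     (\<forall>A \<in> sets \<mu>. T -` A \<inter> space \<mu> = A \<longrightarrow> measure \<mu> A = 0 \<or> measure \<mu> A = 1)"

end

theory Submission
  imports Defs
begin

text \<open>
  One step of the walk averages translates, so the energy \<open>\<parallel>p\<^sup>k(0,\<cdot>)\<parallel>\<^sup>2\<close> decreases at step \<open>k\<close> by exactly
  \<open>1/2 \<Sum>\<^bsub>w,v\<^esub> p(w)p(v)\<parallel>p\<^sup>k(w,\<cdot>) - p\<^sup>k(v,\<cdot>)\<parallel>\<^sup>2\<close>. Telescoping shows that \<open>\<Sum>\<^sub>k \<parallel>p\<^sup>k(w,\<cdot>) - p\<^sup>k(v,\<cdot>)\<parallel>\<^sup>2\<close>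
  is finite whenever \<open>p(w), p(v) > 0\<close>. The displacements for which this sum is finite form a
  subgroup, so strong aperiodicity makes it finite for all pairs of points. The terms of the series
  are therefore independent and centred with summable variances, and Kolmogorov's maximal inequality
  gives almost sure convergence. The increment field is a shift-equivariant function of an
  i.i.d. field, and nontrivial shifts of i.i.d. fields are mixing.
\<close>

section \<open>Square summability of differences of transition probabilities\<close>

text \<open>In dimensions one and two \<open>\<Sum>\<^sub>k energy k\<close> diverges, so the two
  halves of a term of the series cannot be summed separately. The energy argument bounds differences
  of rows directly: it needs no decay rate and no case split on the dimension. The energy starts at
  1 and stays nonnegative, so the total dissipation is at most 1. Strong aperiodicity is used with
  \<open>u = -b\<close> for a support point \<open>b\<close>, because the generators then are
  differences of support points, exactly the displacements that dissipation controls.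

  \<open>Delta\<close> is built with the total operator \<open>lim\<close>, so it is a function of
  the noise everywhere, even where the series diverges. Measurability and shift equivariance
  therefore hold without exceptional null sets, and a strictly invariant set of increments pulls
  back to a strictly invariant set of noise.

  Mixing is exact after finitely many shifts for finite-dimensional boxes. A Dynkin argument frees
  only one of the two sets from being a box, so it is run twice, with shift invariance exchanging
  the roles of the sets in between.\<close>

lemma finite_support_summable_on:
  fixes f :: "'a \<Rightarrow> real"
  assumes "finite {x. f x \<noteq> 0}"
  shows "f summable_on UNIV"
proof -
  have "f summable_on {x. f x \<noteq> 0}" using assms by (rule summable_on_finite)
  then show ?thesis
    by (rule summable_on_cong_neutral[THEN iffD1, rotated -1]) auto
qed

lemma infsum_eq_sum_support:
  fixes f :: "'a \<Rightarrow> real"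
  assumes "finite B" "\<And>x. x \<notin> B \<Longrightarrow> f x = 0"
  shows "infsum f UNIV = sum f B"
  by (rule infsumI, rule has_sum_finite_neutralI[OF assms(1)]) (use assms in auto)

text \<open>For probability weights this is the variance of \<open>f\<close> written as half the
  mean squared difference of two independent samples. The double sum becomes the energy lost in one
  step.\<close>

lemma weighted_mean_square:
  fixes q :: "'a \<Rightarrow> real"
  assumes "sum q S = 1"
  shows "(\<Sum>w\<in>S. q w * f w)\<^sup>2
    = (\<Sum>w\<in>S. q w * (f w)\<^sup>2) - (\<Sum>w\<in>S. \<Sum>v\<in>S. q w * q v * (f w - f v)\<^sup>2) / 2"
proof -
  have "(\<Sum>w\<in>S. \<Sum>v\<in>S. q w * q v * (f w - f v)\<^sup>2)
      = (\<Sum>w\<in>S. \<Sum>v\<in>S. q w * (f w)\<^sup>2 * q v + q w * (q v * (f v)\<^sup>2) - 2 * (q w * f w * (q v * f v)))"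
    by (intro sum.cong refl) (simp add: power2_eq_square algebra_simps)
  also have "\<dots> = 2 * (\<Sum>w\<in>S. q w * (f w)\<^sup>2) - 2 * (\<Sum>w\<in>S. q w * f w)\<^sup>2"
    by (simp add: sum.distrib sum_subtractf flip: sum_distrib_left sum_distrib_right)
       (simp add: assms power2_eq_square flip: sum_distrib_left sum_distrib_right)
  finally show ?thesis by (simp add: field_simps)
qed

lemma gen_add_subgroup_subset:
  assumes "add_subgroup H" "S \<subseteq> H"
  shows "gen_add_subgroup S \<subseteq> H"
  using assms by (auto simp: gen_add_subgroup_def)

section \<open>Energy dissipation for finite-range kernels\<close>

locale walk_kernel =
  fixes p :: "int^'d \<Rightarrow> real"
  assumes nonneg: "0 \<le> p x"
    and finite_support: "finite {x. p x \<noteq> 0}"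
    and sum_one: "(\<Sum>x | p x \<noteq> 0. p x) = 1"
    and aperiodic: "strongly_aperiodic p"
begin

lemma infsum_kernel: "(\<Sum>\<^sub>\<infinity>z. p z * f z) = (\<Sum>z | p z \<noteq> 0. p z * f z)"
  by (rule infsum_eq_sum_support[OF finite_support]) auto

lemma trans_pow_translate: "trans_pow p k (x + a) (y + a) = trans_pow p k x y"
proof (induction k arbitrary: x)
  case (Suc k)
  have bij: "bij (\<lambda>z. z + a)" by (rule bij_plus_right)
  have "trans_pow p (Suc k) (x + a) (y + a)
      = (\<Sum>\<^sub>\<infinity>z. p ((z + a) - (x + a)) * trans_pow p k (z + a) (y + a))"
    by (simp only: trans_pow.simps)
       (rule infsum_reindex_bij_betw[OF bij, symmetric, where f="\<lambda>z. p (z - (x + a)) * trans_pow p k z (y + a)"])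
  then show ?case by (simp add: Suc)
qed simp

text \<open>Recentring the sum at \<open>x\<close> exhibits the first step as a finite average of
  rows started at the points \<open>x + w\<close>.\<close>

lemma trans_pow_Suc:
  "trans_pow p (Suc k) x y = (\<Sum>w | p w \<noteq> 0. p w * trans_pow p k (x + w) y)"
proof -
  have bij: "bij (\<lambda>z. z + x)" by (rule bij_plus_right)
  have "trans_pow p (Suc k) x y = (\<Sum>\<^sub>\<infinity>z. p ((z + x) - x) * trans_pow p k (z + x) y)"
    by (simp only: trans_pow.simps)
       (rule infsum_reindex_bij_betw[OF bij, symmetric, where f="\<lambda>z. p (z - x) * trans_pow p k z y"])
  then show ?thesis by (simp add: infsum_kernel add.commute)
qed

lemma finite_trans_support: "finite {y. trans_pow p k x y \<noteq> 0}"
proof (induction k arbitrary: x)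
  case (Suc k)
  have "{y. trans_pow p (Suc k) x y \<noteq> 0} \<subseteq> (\<Union>w\<in>{w. p w \<noteq> 0}. {y. trans_pow p k (x + w) y \<noteq> 0})"
  proof
    fix y assume "y \<in> {y. trans_pow p (Suc k) x y \<noteq> 0}"
    then have "(\<Sum>w | p w \<noteq> 0. p w * trans_pow p k (x + w) y) \<noteq> 0"
      by (simp only: trans_pow_Suc mem_Collect_eq not_False_eq_True)
    then obtain w where "w \<in> {w. p w \<noteq> 0}" "p w * trans_pow p k (x + w) y \<noteq> 0"
      by (rule sum.not_neutral_contains_not_neutral)
    then show "y \<in> (\<Union>w\<in>{w. p w \<noteq> 0}. {y. trans_pow p k (x + w) y \<noteq> 0})" by auto
  qed
  then show ?case using Suc finite_support by (meson finite_UN finite_subset)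
qed (auto intro: finite_subset[of _ "{x}"])

text \<open>This is the probability that two independent copies of the walk, started at the same
  point, are together at time \<open>k\<close>.\<close>

definition energy :: "nat \<Rightarrow> real" where
  "energy k = (\<Sum>\<^sub>\<infinity>z. (trans_pow p k 0 z)\<^sup>2)"

text \<open>Squared l2 distance between two rows. Multiplied by the noise variance, it is the
  variance of the \<open>k\<close>-th term of the increment series.\<close>

definition trans_dist :: "nat \<Rightarrow> int^'d \<Rightarrow> int^'d \<Rightarrow> real" where
  "trans_dist k x y = (\<Sum>\<^sub>\<infinity>z. (trans_pow p k x z - trans_pow p k y z)\<^sup>2)"

lemma finite_diff_support: "finite {z. trans_pow p k x z - trans_pow p k y z \<noteq> 0}"
  by (rule finite_subset[of _ "{z. trans_pow p k x z \<noteq> 0} \<union> {z. trans_pow p k y z \<noteq> 0}"])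
     (auto intro: finite_trans_support)

lemma summable_diff_square: "(\<lambda>z. (trans_pow p k x z - trans_pow p k y z)\<^sup>2) summable_on UNIV"
  by (rule finite_support_summable_on) (use finite_diff_support[of k x y] in simp)

lemma trans_dist_nonneg: "0 \<le> trans_dist k x y"
  unfolding trans_dist_def by (rule infsum_nonneg) simp

lemma energy_nonneg: "0 \<le> energy k"
  unfolding energy_def by (rule infsum_nonneg) simp

lemma trans_dist_translate: "trans_dist k (x + a) (y + a) = trans_dist k x y"
proof -
  have "trans_dist k (x + a) (y + a)
      = (\<Sum>\<^sub>\<infinity>z. (trans_pow p k (x + a) (z + a) - trans_pow p k (y + a) (z + a))\<^sup>2)"
    unfolding trans_dist_def
    by (rule infsum_reindex_bij_betw[OF bij_plus_right, symmetric,
          where f="\<lambda>z. (trans_pow p k (x + a) z - trans_pow p k (y + a) z)\<^sup>2"])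
  then show ?thesis by (simp add: trans_pow_translate trans_dist_def)
qed

lemma energy_eq: "(\<Sum>\<^sub>\<infinity>z. (trans_pow p k x z)\<^sup>2) = energy k"
proof -
  have "(\<Sum>\<^sub>\<infinity>z. (trans_pow p k x z)\<^sup>2) = (\<Sum>\<^sub>\<infinity>z. (trans_pow p k (0 + x) (z + x))\<^sup>2)"
    using infsum_reindex_bij_betw[OF bij_plus_right[of x], of "\<lambda>z. (trans_pow p k x z)\<^sup>2"] by simp
  then show ?thesis by (simp only: trans_pow_translate energy_def)
qed

text \<open>The variance identity with weights \<open>p\<close> is applied at each site
  \<open>z\<close> and summed over \<open>z\<close>. By translation invariance every row has the
  same energy, so the mean of the squares is \<open>energy k\<close>.\<close>

lemma energy_Suc:
  "energy (Suc k) = energy k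
     - (\<Sum>w | p w \<noteq> 0. \<Sum>v | p v \<noteq> 0. p w * p v * trans_dist k w v) / 2"
proof -
  let ?S = "{w. p w \<noteq> 0}"
  define P where "P w z = trans_pow p k w z" for w z
  \<comment> \<open>One finite set carries all rows started in the support, so every infinite sum
    becomes a sum over \<open>B\<close> and the order of summation can be exchanged.\<close>
  obtain B where B: "finite B" "\<And>w z. w \<in> ?S \<Longrightarrow> z \<notin> B \<Longrightarrow> P w z = 0"
  proof
    show "finite (\<Union>w\<in>?S. {z. P w z \<noteq> 0})"
      using finite_support finite_trans_support by (auto simp: P_def)
  qed (auto simp: P_def)
  have step: "trans_pow p (Suc k) 0 z = (\<Sum>w\<in>?S. p w * P w z)" for z
    by (simp add: trans_pow_Suc P_def del: trans_pow.simps)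
  have en: "(\<Sum>z\<in>B. (P w z)\<^sup>2) = energy k" if "w \<in> ?S" for w
    unfolding energy_eq[of k w, symmetric] P_def
    by (rule infsum_eq_sum_support[symmetric]) (use B that in \<open>auto simp: P_def\<close>)
  have td: "(\<Sum>z\<in>B. (P w z - P v z)\<^sup>2) = trans_dist k w v" if "w \<in> ?S" "v \<in> ?S" for w v
    unfolding trans_dist_def P_def
    by (rule infsum_eq_sum_support[symmetric]) (use B that in \<open>auto simp: P_def\<close>)
  have "energy (Suc k) = (\<Sum>z\<in>B. (\<Sum>w\<in>?S. p w * P w z)\<^sup>2)"
    unfolding energy_def step by (rule infsum_eq_sum_support) (use B in auto)
  also have "\<dots> = (\<Sum>z\<in>B. (\<Sum>w\<in>?S. p w * (P w z)\<^sup>2)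
      - (\<Sum>w\<in>?S. \<Sum>v\<in>?S. p w * p v * (P w z - P v z)\<^sup>2) / 2)"
    by (simp only: weighted_mean_square[OF sum_one])
  also have "\<dots> = (\<Sum>w\<in>?S. p w * (\<Sum>z\<in>B. (P w z)\<^sup>2))
      - (\<Sum>w\<in>?S. \<Sum>v\<in>?S. p w * p v * (\<Sum>z\<in>B. (P w z - P v z)\<^sup>2)) / 2"
    unfolding sum_subtractf sum_divide_distrib[symmetric] sum_distrib_left
    by (subst sum.swap, subst (2) sum.swap, subst (3) sum.swap) (rule refl)
  also have "(\<Sum>w\<in>?S. p w * (\<Sum>z\<in>B. (P w z)\<^sup>2)) = (\<Sum>w\<in>?S. p w * energy k)"
    by (intro sum.cong refl) (simp only: en)
  also have "\<dots> = energy k"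
    by (simp add: sum_one flip: sum_distrib_right)
  also have "(\<Sum>w\<in>?S. \<Sum>v\<in>?S. p w * p v * (\<Sum>z\<in>B. (P w z - P v z)\<^sup>2))
      = (\<Sum>w\<in>?S. \<Sum>v\<in>?S. p w * p v * trans_dist k w v)"
    by (intro sum.cong refl) (simp only: td)
  finally show ?thesis .
qed

lemma energy_0: "energy 0 = 1"
  unfolding energy_def by (subst infsum_eq_sum_support[of "{0}"]) auto

lemma summable_trans_dist_support:
  assumes "p a \<noteq> 0" "p b \<noteq> 0"
  shows "summable (\<lambda>k. trans_dist k a b)"
proof -
  let ?S = "{w. p w \<noteq> 0}"
  define D where "D k = (\<Sum>w\<in>?S. \<Sum>v\<in>?S. p w * p v * trans_dist k w v)" for k
  \<comment> \<open>The factor 2 undoes the one half in the dissipation formula, and the 1 is the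
    initial energy.\<close>
  have tele: "(\<Sum>k<n. D k) = 2 * (1 - energy n)" for n
    by (induction n) (simp_all add: energy_0 energy_Suc D_def)
  \<comment> \<open>A single pair of support points contributes one nonnegative summand of the
    dissipation, with the fixed positive weight \<open>p a * p b\<close>.\<close>
  have le: "p a * p b * trans_dist k a b \<le> D k" for k
  proof -
    have "p a * p b * trans_dist k a b \<le> (\<Sum>v\<in>?S. p a * p v * trans_dist k a v)"
      using assms finite_support
      by (intro member_le_sum[where f="\<lambda>v. p a * p v * trans_dist k a v"])
         (auto intro!: mult_nonneg_nonneg nonneg trans_dist_nonneg)
    also have "\<dots> \<le> D k"
      unfolding D_def using assms finite_support
      by (intro member_le_sum[where f="\<lambda>w. \<Sum>v\<in>?S. p w * p v * trans_dist k w v"])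
         (auto intro!: sum_nonneg mult_nonneg_nonneg nonneg trans_dist_nonneg)
    finally show ?thesis .
  qed
  have pos: "p a * p b > 0" using assms nonneg[of a] nonneg[of b] by (simp add: order_less_le)
  have "summable D"
  proof (rule summableI_nonneg_bounded)
    show "0 \<le> D k" for k
      unfolding D_def by (intro sum_nonneg mult_nonneg_nonneg nonneg trans_dist_nonneg)
    show "(\<Sum>k<n. D k) \<le> 2" for n unfolding tele using energy_nonneg[of n] by simp
  qed
  then have "summable (\<lambda>k. p a * p b * trans_dist k a b)"
    by (rule summable_comparison_test'[where N=0])
       (use le pos trans_dist_nonneg in \<open>auto simp: abs_of_nonneg\<close>)
  then show ?thesis using assms by simp
qed

text \<open>For squared distances the triangle inequality costs a factor 2, which is harmless for
  summability. Pointwise the gap between the two sides is the square of a difference.\<close>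

lemma trans_dist_triangle: "trans_dist k x z \<le> 2 * trans_dist k x y + 2 * trans_dist k y z"
proof -
  let ?f = "\<lambda>x y w. trans_pow p k x w - trans_pow p k y w"
  have "trans_dist k x z \<le> (\<Sum>\<^sub>\<infinity>w. 2 * (?f x y w)\<^sup>2 + 2 * (?f y z w)\<^sup>2)"
    unfolding trans_dist_def
  proof (rule infsum_mono)
    show "(\<lambda>w. 2 * (?f x y w)\<^sup>2 + 2 * (?f y z w)\<^sup>2) summable_on UNIV"
      by (intro summable_on_add summable_on_cmult_right summable_diff_square)
    fix w
    have "2 * (?f x y w)\<^sup>2 + 2 * (?f y z w)\<^sup>2 - (?f x z w)\<^sup>2 = (?f x y w - ?f y z w)\<^sup>2"
      by (simp add: power2_eq_square algebra_simps)
    then show "(?f x z w)\<^sup>2 \<le> 2 * (?f x y w)\<^sup>2 + 2 * (?f y z w)\<^sup>2"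
      using zero_le_power2[of "?f x y w - ?f y z w"] by linarith
  qed (rule summable_diff_square)
  also have "\<dots> = 2 * trans_dist k x y + 2 * trans_dist k y z"
    unfolding trans_dist_def
    by (subst infsum_add) (auto intro!: summable_on_cmult_right summable_diff_square simp: infsum_cmult_right')
  finally show ?thesis .
qed

lemma trans_dist_sym: "trans_dist k x y = trans_dist k y x"
  unfolding trans_dist_def by (simp add: power2_commute)

proposition summable_trans_dist: "summable (\<lambda>k. trans_dist k x y)"
proof -
  define H where "H = {h. summable (\<lambda>k. trans_dist k 0 h)}"
  obtain b where b: "p b \<noteq> 0" using sum_one by fastforce
  have sub: "add_subgroup H"
    unfolding add_subgroup_def
  proof (intro conjI ballI)
    have "trans_dist k 0 0 = 0" for k by (simp add: trans_dist_def)
    then show "0 \<in> H" by (simp add: H_def)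
  next
    fix a assume a: "a \<in> H"
    have "trans_dist k 0 (- a) = trans_dist k 0 a" for k
      using trans_dist_translate[of k 0 a "- a"] trans_dist_sym[of k a 0] by simp
    then show "- a \<in> H" using a by (simp add: H_def)
  next
    fix a c assume a: "a \<in> H" and c: "c \<in> H"
    have "trans_dist k a (a + c) = trans_dist k 0 c" for k
      using trans_dist_translate[of k 0 a c] by (simp add: add.commute)
    then have le: "trans_dist k 0 (a + c) \<le> 2 * trans_dist k 0 a + 2 * trans_dist k 0 c" for k
      using trans_dist_triangle[of k 0 "a + c" a] by simp
    have "summable (\<lambda>k. 2 * trans_dist k 0 a + 2 * trans_dist k 0 c)"
      using a c by (intro summable_add summable_mult) (auto simp: H_def)
    then have "summable (\<lambda>k. trans_dist k 0 (a + c))"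
      by (rule summable_comparison_test') (use le in \<open>simp add: trans_dist_nonneg\<close>)
    then show "a + c \<in> H" by (simp add: H_def)
  qed
  \<comment> \<open>Shifting by \<open>- b\<close> turns the support into displacements between
    support points; translation invariance reduces each of them to the pair \<open>b\<close>,
    \<open>x\<close>.\<close>
  have "{- b + x | x. p x > 0} \<subseteq> H"
  proof
    fix h assume "h \<in> {- b + x | x. p x > 0}"
    then obtain x where x: "h = x - b" "0 < p x" by auto
    have "trans_dist k 0 (x - b) = trans_dist k b x" for k
      using trans_dist_translate[of k b "- b" x] by simp
    then show "h \<in> H"
      using summable_trans_dist_support[OF b, of x] x by (simp add: H_def)
  qed
  then have "gen_add_subgroup {- b + x | x. p x > 0} \<subseteq> H"
    by (rule gen_add_subgroup_subset[OF sub])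
  then have "H = UNIV"
    using aperiodic unfolding strongly_aperiodic_def by (metis top.extremum_uniqueI)
  then have "y - x \<in> H" by simp
  moreover have "trans_dist k 0 (y - x) = trans_dist k x y" for k
    using trans_dist_translate[of k x "- x" y] by simp
  ultimately show ?thesis by (simp add: H_def)
qed

end

section \<open>Series of independent centred variables\<close>

context prob_space
begin

lemma integrable_mult_square:
  fixes f g :: "'a \<Rightarrow> real"
  assumes [measurable]: "f \<in> borel_measurable M" "g \<in> borel_measurable M"
    and f: "integrable M (\<lambda>x. (f x)\<^sup>2)" and g: "integrable M (\<lambda>x. (g x)\<^sup>2)"
  shows "integrable M (\<lambda>x. f x * g x)"
proof (rule Bochner_Integration.integrable_bound)
  show "integrable M (\<lambda>x. (f x)\<^sup>2 + (g x)\<^sup>2)" using f g by simp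
  show "AE x in M. norm (f x * g x) \<le> norm ((f x)\<^sup>2 + (g x)\<^sup>2)"
  proof (rule AE_I2)
    fix x
    have "2 * (\<bar>f x\<bar> * \<bar>g x\<bar>) \<le> (f x)\<^sup>2 + (g x)\<^sup>2"
      using zero_le_power2[of "\<bar>f x\<bar> - \<bar>g x\<bar>"] by (simp add: power2_diff)
    moreover have "0 \<le> \<bar>f x\<bar> * \<bar>g x\<bar>" by simp
    ultimately have "\<bar>f x\<bar> * \<bar>g x\<bar> \<le> (f x)\<^sup>2 + (g x)\<^sup>2" by linarith
    then show "norm (f x * g x) \<le> norm ((f x)\<^sup>2 + (g x)\<^sup>2)"
      by (simp add: abs_mult)
  qed
qed measurable

lemma orthogonal_sum_square:
  fixes Y :: "'i \<Rightarrow> 'a \<Rightarrow> real"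
  assumes "finite I"
    and meas: "\<And>i. i \<in> I \<Longrightarrow> Y i \<in> borel_measurable M"
    and sq: "\<And>i. i \<in> I \<Longrightarrow> integrable M (\<lambda>x. (Y i x)\<^sup>2)"
    and orth: "\<And>i j. i \<in> I \<Longrightarrow> j \<in> I \<Longrightarrow> i \<noteq> j \<Longrightarrow> expectation (\<lambda>x. Y i x * Y j x) = 0"
  shows "integrable M (\<lambda>x. (\<Sum>i\<in>I. Y i x)\<^sup>2)"
    and "expectation (\<lambda>x. (\<Sum>i\<in>I. Y i x)\<^sup>2) = (\<Sum>i\<in>I. expectation (\<lambda>x. (Y i x)\<^sup>2))"
proof -
  have int: "integrable M (\<lambda>x. Y i x * Y j x)" if "i \<in> I" "j \<in> I" for i j
    using that by (intro integrable_mult_square meas sq)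
  have eq: "(\<Sum>i\<in>I. Y i x)\<^sup>2 = (\<Sum>i\<in>I. \<Sum>j\<in>I. Y i x * Y j x)" for x
    by (simp add: power2_eq_square sum_product)
  show "integrable M (\<lambda>x. (\<Sum>i\<in>I. Y i x)\<^sup>2)"
    unfolding eq by (intro Bochner_Integration.integrable_sum int)
  have "expectation (\<lambda>x. (\<Sum>i\<in>I. Y i x)\<^sup>2) = (\<Sum>i\<in>I. \<Sum>j\<in>I. expectation (\<lambda>x. Y i x * Y j x))"
    unfolding eq
    by (subst Bochner_Integration.integral_sum, intro Bochner_Integration.integrable_sum int, assumption+)
       (intro sum.cong refl Bochner_Integration.integral_sum int)
  also have "\<dots> = (\<Sum>i\<in>I. \<Sum>j\<in>I. if i = j then expectation (\<lambda>x. (Y i x)\<^sup>2) else 0)"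
    by (intro sum.cong refl) (auto simp: orth power2_eq_square)
  also have "\<dots> = (\<Sum>i\<in>I. expectation (\<lambda>x. (Y i x)\<^sup>2))"
    using \<open>finite I\<close> by simp
  finally show "expectation (\<lambda>x. (\<Sum>i\<in>I. Y i x)\<^sup>2) = (\<Sum>i\<in>I. expectation (\<lambda>x. (Y i x)\<^sup>2))" .
qed

lemma integrable_of_square:
  fixes f :: "'a \<Rightarrow> real"
  assumes "f \<in> borel_measurable M" "integrable M (\<lambda>x. (f x)\<^sup>2)"
  shows "integrable M f"
  using integrable_mult_square[of f "\<lambda>_. 1"] assms by simp

lemma indep_vars_orthogonal:
  fixes Y :: "'i \<Rightarrow> 'a \<Rightarrow> real"
  assumes ind: "indep_vars (\<lambda>_. borel) Y I" and I: "i \<in> I" "j \<in> I" "i \<noteq> j"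
    and int: "\<And>i. i \<in> I \<Longrightarrow> integrable M (Y i)"
    and mean: "\<And>i. i \<in> I \<Longrightarrow> expectation (Y i) = 0"
  shows "expectation (\<lambda>x. Y i x * Y j x) = 0"
proof -
  have "indep_vars (\<lambda>_. borel) Y {i, j}"
    using ind by (rule indep_vars_subset) (use I in auto)
  then have "expectation (\<lambda>x. \<Prod>k\<in>{i, j}. Y k x) = (\<Prod>k\<in>{i, j}. expectation (Y k))"
    by (intro indep_vars_lebesgue_integral) (use I int in auto)
  then show ?thesis using I mean by simp
qed

end

locale indep_centered = prob_space M for M :: "'a measure" +
  fixes X :: "nat \<Rightarrow> 'a \<Rightarrow> real"
  assumes indep: "indep_vars (\<lambda>_. borel) X UNIV"
    and square: "integrable M (\<lambda>x. (X n x)\<^sup>2)"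
    and mean: "expectation (X n) = 0"
begin

lemma measurable_X [measurable]: "X n \<in> borel_measurable M"
  using indep by (auto simp: indep_vars_def)

lemma integrable_X: "integrable M (X n)"
  by (rule integrable_of_square) (auto intro: square)

lemma orthogonal: "i \<noteq> j \<Longrightarrow> expectation (\<lambda>x. X i x * X j x) = 0"
  using indep by (rule indep_vars_orthogonal) (auto intro: integrable_X mean)

lemma shifted: "indep_centered M (\<lambda>n. X (m + n))"
proof
  \<comment> \<open>Reindexing is expressed as grouping the family into the disjoint singleton
    blocks \<open>{m + k}\<close>.\<close>
  have "indep_vars (\<lambda>k. borel) (\<lambda>k \<omega>. (restrict (\<lambda>i. X i \<omega>) {m + k}) (m + k)) UNIV"
    by (rule indep_vars_compose2[OF indep_vars_restrict[OF indep]])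
       (auto simp: disjoint_family_on_def)
  then show "indep_vars (\<lambda>_. borel) (\<lambda>n. X (m + n)) UNIV" by simp
qed (auto intro: square mean)

section \<open>Orthogonality and Kolmogorov's maximal inequality\<close>

lemma
  assumes "finite I"
  shows integrable_sum_X_square: "integrable M (\<lambda>x. (\<Sum>i\<in>I. X i x)\<^sup>2)"
    and expectation_sum_X_square:
      "expectation (\<lambda>x. (\<Sum>i\<in>I. X i x)\<^sup>2) = (\<Sum>i\<in>I. expectation (\<lambda>x. (X i x)\<^sup>2))"
  using orthogonal_sum_square[of I X] assms by (auto simp: square orthogonal)

text \<open>The past enters as a function \<open>f\<close> on coordinate space, so that independence
  of two disjoint blocks applies; the centred future then makes the product of expectations
  vanish.\<close>

lemma expectation_past_future:
  assumes f: "f \<in> borel_measurable (PiM {..<m} (\<lambda>_. borel))"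
    and int: "integrable M (\<lambda>\<omega>. f (restrict (\<lambda>i. X i \<omega>) {..<m}) :: real)"
  shows "expectation (\<lambda>\<omega>. f (restrict (\<lambda>i. X i \<omega>) {..<m}) * (\<Sum>i\<in>{m..<n}. X i \<omega>)) = 0"
proof -
  have "indep_var (PiM {..<m} (\<lambda>_. borel)) (\<lambda>\<omega>. restrict (\<lambda>i. X i \<omega>) {..<m})
      (PiM {m..<n} (\<lambda>_. borel)) (\<lambda>\<omega>. restrict (\<lambda>i. X i \<omega>) {m..<n})"
    by (rule indep_var_restrict[OF indep]) auto
  then have "indep_var borel (f \<circ> (\<lambda>\<omega>. restrict (\<lambda>i. X i \<omega>) {..<m}))
      borel ((\<lambda>y. \<Sum>i\<in>{m..<n}. y i) \<circ> (\<lambda>\<omega>. restrict (\<lambda>i. X i \<omega>) {m..<n}))"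
    by (rule indep_var_compose) (use f in measurable)
  then have ind: "indep_var borel (\<lambda>\<omega>. f (restrict (\<lambda>i. X i \<omega>) {..<m})) borel (\<lambda>\<omega>. \<Sum>i\<in>{m..<n}. X i \<omega>)"
    by (simp add: comp_def)
  have "expectation (\<lambda>\<omega>. f (restrict (\<lambda>i. X i \<omega>) {..<m}) * (\<Sum>i\<in>{m..<n}. X i \<omega>))
      = expectation (\<lambda>\<omega>. f (restrict (\<lambda>i. X i \<omega>) {..<m})) * expectation (\<lambda>\<omega>. \<Sum>i\<in>{m..<n}. X i \<omega>)"
    by (rule indep_var_lebesgue_integral[OF ind int]) (intro Bochner_Integration.integrable_sum integrable_X)
  also have "expectation (\<lambda>\<omega>. \<Sum>i\<in>{m..<n}. X i \<omega>) = 0"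
    by (simp add: integrable_X mean)
  finally show ?thesis by (simp only: mult_zero_right)
qed

theorem kolmogorov_maximal_inequality:
  assumes \<epsilon>: "0 < \<epsilon>"
  shows "prob {x \<in> space M. \<exists>m\<le>n. \<epsilon> \<le> \<bar>\<Sum>i<m. X i x\<bar>} \<le> (\<Sum>i<n. expectation (\<lambda>x. (X i x)\<^sup>2)) / \<epsilon>\<^sup>2"
proof -
  define S where "S m x = (\<Sum>i<m. X i x)" for m x
  have [measurable]: "S m \<in> borel_measurable M" for m unfolding S_def by measurable
  \<comment> \<open>Indicator that \<open>m\<close> is the first time at which the partial sums
    reach size \<open>\<epsilon>\<close>. It depends on the first \<open>m\<close> variables
    only.\<close>
  define F where "F m x = (if \<epsilon> \<le> \<bar>S m x\<bar> \<and> (\<forall>j<m. \<bar>S j x\<bar> < \<epsilon>) then 1 else 0 :: real)" for m x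
  have [measurable]: "F m \<in> borel_measurable M" for m unfolding F_def by measurable
  have F01: "0 \<le> F m x" "F m x \<le> 1" for m x by (auto simp: F_def)
  have intS: "integrable M (\<lambda>x. (S m x)\<^sup>2)" for m
    unfolding S_def by (rule integrable_sum_X_square) simp
  have intFS: "integrable M (\<lambda>x. F m x * (S k x)\<^sup>2)" for m k
    by (rule Bochner_Integration.integrable_bound[OF intS[of k]]) (auto simp: abs_mult F_def)
  have Fle: "\<epsilon>\<^sup>2 * expectation (F m) \<le> expectation (\<lambda>x. F m x * (S n x)\<^sup>2)" if "m \<le> n" for m
  proof -
    let ?R = "\<lambda>x. \<Sum>i\<in>{m..<n}. X i x"
    \<comment> \<open>This is \<open>F m x * S m x\<close> rewritten as a function of the first
      \<open>m\<close> coordinates, the form needed for orthogonality to the future.\<close>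
    define g where "g y = (let s = (\<lambda>k. \<Sum>i<k. y i) in
      (if \<epsilon> \<le> \<bar>s m\<bar> \<and> (\<forall>j<m. \<bar>s j\<bar> < \<epsilon>) then 1 else 0) * s m)" for y :: "nat \<Rightarrow> real"
    have g: "g (restrict (\<lambda>i. X i x) {..<m}) = F m x * S m x" for x
    proof -
      have "(\<Sum>i<k. restrict (\<lambda>i. X i x) {..<m} i) = S k x" if "k \<le> m" for k
        unfolding S_def by (intro sum.cong) (use that in auto)
      then show ?thesis by (simp add: g_def F_def)
    qed
    have gm: "g \<in> borel_measurable (PiM {..<m} (\<lambda>_. borel))"
    proof -
      have meas_sum: "(\<lambda>y. \<Sum>i<k. y i) \<in> borel_measurable (PiM {..<m} (\<lambda>_. borel :: real measure))"
        if "k \<le> m" for k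
        by (rule borel_measurable_sum) (use that in \<open>auto intro!: measurable_component_singleton\<close>)
      have [measurable]: "Measurable.pred (PiM {..<m} (\<lambda>_. borel :: real measure)) (\<lambda>y. \<bar>\<Sum>i<k. y i\<bar> < \<epsilon>)"
        if "k < m" for k
      proof -
        have [measurable]: "(\<lambda>y. \<Sum>i<k. y i) \<in> borel_measurable (PiM {..<m} (\<lambda>_. borel :: real measure))"
          by (rule meas_sum) (use that in simp)
        show ?thesis by measurable
      qed
      have "Measurable.pred (PiM {..<m} (\<lambda>_. borel :: real measure)) (\<lambda>y. \<forall>k\<in>{..<m}. \<bar>\<Sum>i<k. y i\<bar> < \<epsilon>)"
        by (rule pred_intros_finite) auto
      then have [measurable]: "Measurable.pred (PiM {..<m} (\<lambda>_. borel :: real measure)) (\<lambda>y. \<forall>k<m. \<bar>\<Sum>i<k. y i\<bar> < \<epsilon>)"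
        by (simp add: Ball_def)
      note [measurable] = meas_sum[OF order_refl]
      show ?thesis unfolding g_def Let_def by measurable
    qed
    have intg: "integrable M (\<lambda>x. F m x * S m x)"
      by (rule Bochner_Integration.integrable_bound[OF integrable_of_square[OF _ intS[of m]]])
         (auto simp: abs_mult F_def)
    have cross: "expectation (\<lambda>x. F m x * S m x * ?R x) = 0"
      using expectation_past_future[OF gm, of n] intg unfolding g by simp
    have intc: "integrable M (\<lambda>x. F m x * S m x * ?R x)"
    proof (rule integrable_mult_square)
      show "integrable M (\<lambda>x. (F m x * S m x)\<^sup>2)"
        by (rule Bochner_Integration.integrable_bound[OF intS[of m]]) (auto simp: F_def)
    qed (auto intro: integrable_sum_X_square)
    have "\<epsilon>\<^sup>2 * expectation (F m) = expectation (\<lambda>x. \<epsilon>\<^sup>2 * F m x)" by simp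
    \<comment> \<open>The subtracted cross term has mean zero, and removing it leaves
      \<open>F m x\<close> times the sum of the squares of \<open>S m x\<close> and of the later
      increment. The first square is at least \<open>\<epsilon>\<^sup>2\<close> where
      \<open>F m x = 1\<close>.\<close>
    also have "\<dots> \<le> expectation (\<lambda>x. F m x * (S n x)\<^sup>2 - 2 * (F m x * S m x * ?R x))"
    proof (rule integral_mono)
      have "integrable M (F m)" by (rule integrable_const_bound[of _ 1]) (auto simp: F_def)
      then show "integrable M (\<lambda>x. \<epsilon>\<^sup>2 * F m x)" by simp
      show "integrable M (\<lambda>x. F m x * (S n x)\<^sup>2 - 2 * (F m x * S m x * ?R x))"
        using intFS intc by auto
      fix x
      have "S n x = S m x + ?R x"
        unfolding S_def using that
        by (simp add: sum.atLeastLessThan_concat lessThan_atLeast0)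
      then have "F m x * (S n x)\<^sup>2 - 2 * (F m x * S m x * ?R x) = F m x * (S m x)\<^sup>2 + F m x * (?R x)\<^sup>2"
        by (simp add: power2_eq_square algebra_simps)
      moreover have "\<epsilon>\<^sup>2 * F m x \<le> F m x * (S m x)\<^sup>2"
        using power_mono[of \<epsilon> "\<bar>S m x\<bar>" 2] \<epsilon> by (auto simp: F_def)
      moreover have "0 \<le> F m x * (?R x)\<^sup>2" using F01 by simp
      ultimately show "\<epsilon>\<^sup>2 * F m x \<le> F m x * (S n x)\<^sup>2 - 2 * (F m x * S m x * ?R x)" by linarith
    qed
    also have "\<dots> = expectation (\<lambda>x. F m x * (S n x)\<^sup>2)"
      using intFS intc cross by simp
    finally show ?thesis .
  qed
  \<comment> \<open>The first passage time is unique, so the indicators add up to the indicator of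
    the maximal event.\<close>
  have sumF: "(\<Sum>m\<le>n. F m x) = indicator {x \<in> space M. \<exists>m\<le>n. \<epsilon> \<le> \<bar>S m x\<bar>} x" if "x \<in> space M" for x
  proof (cases "\<exists>m\<le>n. \<epsilon> \<le> \<bar>S m x\<bar>")
    case True
    define l where "l = (LEAST m. \<epsilon> \<le> \<bar>S m x\<bar>)"
    obtain m where m: "m \<le> n" "\<epsilon> \<le> \<bar>S m x\<bar>" using True by auto
    have l: "\<epsilon> \<le> \<bar>S l x\<bar>" "\<And>j. j < l \<Longrightarrow> \<bar>S j x\<bar> < \<epsilon>" "l \<le> n"
      unfolding l_def using m by (auto intro: LeastI dest: not_less_Least order_trans[OF Least_le[of _ m]])
    have "F m x = (if m = l then 1 else 0)" for m
      using l unfolding F_def by (metis linorder_neqE_nat not_le)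
    then show ?thesis using l True that by (simp add: indicator_def)
  next
    case False
    then have "F m x = 0" if "m \<le> n" for m using that by (auto simp: F_def)
    then show ?thesis using False by (simp add: indicator_def)
  qed
  have intF: "integrable M (F m)" for m
    by (rule integrable_const_bound[of _ 1]) (auto simp: F_def)
  have "\<epsilon>\<^sup>2 * prob {x \<in> space M. \<exists>m\<le>n. \<epsilon> \<le> \<bar>S m x\<bar>}
      = \<epsilon>\<^sup>2 * expectation (\<lambda>x. \<Sum>m\<le>n. F m x)"
    by (subst Bochner_Integration.integral_cong[OF refl sumF]) simp_all
  also have "\<dots> = (\<Sum>m\<le>n. \<epsilon>\<^sup>2 * expectation (F m))"
    by (simp add: intF sum_distrib_left)
  also have "\<dots> \<le> (\<Sum>m\<le>n. expectation (\<lambda>x. F m x * (S n x)\<^sup>2))"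
    by (intro sum_mono Fle) simp
  also have "\<dots> = expectation (\<lambda>x. (\<Sum>m\<le>n. F m x) * (S n x)\<^sup>2)"
    unfolding sum_distrib_right by (simp add: intFS)
  also have "\<dots> \<le> expectation (\<lambda>x. (S n x)\<^sup>2)"
  proof (rule integral_mono)
    show "integrable M (\<lambda>x. (\<Sum>m\<le>n. F m x) * (S n x)\<^sup>2)"
      unfolding sum_distrib_right by (intro Bochner_Integration.integrable_sum intFS)
    fix x assume "x \<in> space M"
    then show "(\<Sum>m\<le>n. F m x) * (S n x)\<^sup>2 \<le> (S n x)\<^sup>2"
      by (simp only: sumF) (simp add: indicator_def)
  qed (rule intS)
  also have "\<dots> = (\<Sum>i<n. expectation (\<lambda>x. (X i x)\<^sup>2))"
    unfolding S_def by (rule expectation_sum_X_square) simp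
  finally show ?thesis
    using \<epsilon> by (simp add: S_def pos_le_divide_eq mult.commute)
qed

end

section \<open>Almost sure and L2 convergence under summable variances\<close>

locale indep_centered_summable = indep_centered +
  assumes summable_square: "summable (\<lambda>n. expectation (\<lambda>x. (X n x)\<^sup>2))"
begin

text \<open>The maximal inequality bounds every finite horizon by the same tail of variances, and
  continuity from below removes the horizon.\<close>

lemma prob_tail_oscillation:
  assumes \<epsilon>: "0 < \<epsilon>"
  shows "prob {x \<in> space M. \<exists>k. \<epsilon> \<le> \<bar>\<Sum>i<k. X (m + i) x\<bar>}
    \<le> (\<Sum>i. expectation (\<lambda>x. (X (m + i) x)\<^sup>2)) / \<epsilon>\<^sup>2"
proof -
  interpret sh: indep_centered M "\<lambda>n. X (m + n)" by (rule shifted)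
  let ?A = "\<lambda>n. {x \<in> space M. \<exists>k\<le>n. \<epsilon> \<le> \<bar>\<Sum>i<k. X (m + i) x\<bar>}"
  have sm: "summable (\<lambda>i. expectation (\<lambda>x. (X (m + i) x)\<^sup>2))"
    using summable_ignore_initial_segment[OF summable_square, of m] by (simp add: add.commute)
  have "(\<lambda>n. prob (?A n)) \<longlonglongrightarrow> prob (\<Union>n. ?A n)"
    by (rule finite_Lim_measure_incseq) (auto simp: incseq_def intro: order_trans)
  moreover have "prob (?A n) \<le> (\<Sum>i. expectation (\<lambda>x. (X (m + i) x)\<^sup>2)) / \<epsilon>\<^sup>2" for n
    using sh.kolmogorov_maximal_inequality[OF \<epsilon>, of n]
      sum_le_suminf[OF sm, of "{..<n}"] \<epsilon>
    by (simp add: divide_right_mono order_trans)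
  ultimately have "prob (\<Union>n. ?A n) \<le> (\<Sum>i. expectation (\<lambda>x. (X (m + i) x)\<^sup>2)) / \<epsilon>\<^sup>2"
    by (intro LIMSEQ_le_const2) auto
  moreover have "(\<Union>n. ?A n) = {x \<in> space M. \<exists>k. \<epsilon> \<le> \<bar>\<Sum>i<k. X (m + i) x\<bar>}" by auto
  ultimately show ?thesis by simp
qed

theorem AE_convergent_sum: "AE x in M. convergent (\<lambda>n. \<Sum>i<n. X i x)"
proof -
  let ?B = "\<lambda>\<epsilon> m. {x \<in> space M. \<exists>k. \<epsilon> \<le> \<bar>\<Sum>i<k. X (m + i) x\<bar>}"
  have null: "AE x in M. \<exists>m. \<forall>k. \<bar>\<Sum>i<k. X (m + i) x\<bar> < \<epsilon>" if \<epsilon>: "0 < \<epsilon>" for \<epsilon>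
  proof -
    \<comment> \<open>The event that the partial sums move by at least \<open>\<epsilon>\<close>
      after every starting index. Each \<open>m\<close> bounds its probability by a tail of a
      convergent series, so it is null.\<close>
    let ?N = "\<Inter>m. ?B \<epsilon> m"
    have "prob ?N \<le> (\<Sum>i. expectation (\<lambda>x. (X (m + i) x)\<^sup>2)) / \<epsilon>\<^sup>2" for m
      by (rule order_trans[OF _ prob_tail_oscillation[OF \<epsilon>, of m]])
         (rule finite_measure_mono, auto)
    moreover have "(\<lambda>m. (\<Sum>i. expectation (\<lambda>x. (X (m + i) x)\<^sup>2)) / \<epsilon>\<^sup>2) \<longlonglongrightarrow> 0 / \<epsilon>\<^sup>2"
      using suminf_exist_split2[OF summable_square] \<epsilon>
      by (intro tendsto_divide) (auto simp: add.commute)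
    ultimately have "prob ?N \<le> 0"
      by (intro LIMSEQ_le_const[of _ 0]) auto
    then have "prob ?N = 0" using measure_nonneg[of M ?N] by linarith
    then have "AE x in M. x \<notin> ?N"
      by (subst prob_eq_0[symmetric]) auto
    then show ?thesis by (rule AE_mp) (auto simp: not_le)
  qed
  \<comment> \<open>Thresholds \<open>1 / Suc j\<close> suffice for the Cauchy criterion and keep
    the exceptional null sets countable in number.\<close>
  have "AE x in M. \<forall>j. \<exists>m. \<forall>k. \<bar>\<Sum>i<k. X (m + i) x\<bar> < 1 / Suc j"
    by (subst AE_all_countable) (auto intro: null)
  then show ?thesis
  proof (rule AE_mp, intro AE_I2 impI)
    fix x assume *: "\<forall>j. \<exists>m. \<forall>k. \<bar>\<Sum>i<k. X (m + i) x\<bar> < 1 / Suc j"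
    have "Cauchy (\<lambda>n. \<Sum>i<n. X i x)"
    proof (rule metric_CauchyI)
      fix e :: real assume "0 < e"
      then obtain j where j: "1 / Suc j < e / 2" using nat_approx_posE[of "e / 2"] by auto
      obtain m where m: "\<And>k. \<bar>\<Sum>i<k. X (m + i) x\<bar> < 1 / Suc j" using * by blast
      have close: "\<bar>(\<Sum>i<n. X i x) - (\<Sum>i<m. X i x)\<bar> < e / 2" if "m \<le> n" for n
      proof -
        have "(\<Sum>i<n. X i x) = (\<Sum>i<m. X i x) + (\<Sum>i<n - m. X (m + i) x)"
          using that sum.atLeastLessThan_concat[of 0 m n "\<lambda>i. X i x"]
            sum.shift_bounds_nat_ivl[of "\<lambda>i. X i x" 0 m "n - m"]
          by (simp add: lessThan_atLeast0 add.commute)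
        then show ?thesis using m[of "n - m"] j by simp
      qed
      show "\<exists>m. \<forall>n\<ge>m. \<forall>n'\<ge>m. dist (\<Sum>i<n. X i x) (\<Sum>i<n'. X i x) < e"
        using close by (intro exI[of _ m] allI impI) (metis dist_real_def dist_triangle_half_l dist_commute)
    qed
    then show "convergent (\<lambda>n. \<Sum>i<n. X i x)" by (rule Cauchy_convergent)
  qed
qed

text \<open>Fatou's lemma in \<open>k\<close>: the squared remainder is the limit of squared finite
  blocks from \<open>n\<close> to \<open>k + n\<close>, whose expectations are finite sums of
  variances below the tail.\<close>

lemma expectation_remainder_square:
  assumes L: "L \<in> borel_measurable M" "AE x in M. (\<lambda>n. \<Sum>i<n. X i x) \<longlonglongrightarrow> L x"
  shows "integrable M (\<lambda>x. ((\<Sum>i<n. X i x) - L x)\<^sup>2)"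
    and "expectation (\<lambda>x. ((\<Sum>i<n. X i x) - L x)\<^sup>2) \<le> (\<Sum>i. expectation (\<lambda>x. (X (i + n) x)\<^sup>2))"
proof -
  note [measurable] = L(1)
  let ?S = "\<lambda>n x. \<Sum>i<n. X i x" and ?V = "\<Sum>i. expectation (\<lambda>x. (X (i + n) x)\<^sup>2)"
  have sm: "summable (\<lambda>i. expectation (\<lambda>x. (X (i + n) x)\<^sup>2))"
    using summable_ignore_initial_segment[OF summable_square] .
  have V0: "0 \<le> ?V" by (rule suminf_nonneg[OF sm]) simp
  have fin: "(\<integral>\<^sup>+x. ennreal ((?S n x - ?S (k + n) x)\<^sup>2) \<partial>M) \<le> ennreal ?V" for k
  proof -
    have "?S (k + n) x - ?S n x = (\<Sum>i\<in>{n..<k + n}. X i x)" for x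
      using sum.atLeastLessThan_concat[of 0 n "k + n" "\<lambda>i. X i x"] by (simp add: lessThan_atLeast0)
    then have eq: "(?S n x - ?S (k + n) x)\<^sup>2 = (\<Sum>i\<in>{n..<k + n}. X i x)\<^sup>2" for x
      by (metis power2_commute)
    have "(\<integral>\<^sup>+x. ennreal ((?S n x - ?S (k + n) x)\<^sup>2) \<partial>M)
        = ennreal (\<Sum>i\<in>{n..<k + n}. expectation (\<lambda>x. (X i x)\<^sup>2))"
      unfolding eq
      by (subst nn_integral_eq_integral) (auto simp: integrable_sum_X_square expectation_sum_X_square)
    also have "(\<Sum>i\<in>{n..<k + n}. expectation (\<lambda>x. (X i x)\<^sup>2)) = (\<Sum>i<k. expectation (\<lambda>x. (X (i + n) x)\<^sup>2))"
      using sum.shift_bounds_nat_ivl[of "\<lambda>i. expectation (\<lambda>x. (X i x)\<^sup>2)" 0 n k] by (simp add: lessThan_atLeast0)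
    also have "\<dots> \<le> ?V"
      by (rule sum_le_suminf[OF sm]) auto
    finally show ?thesis by (simp add: ennreal_leI)
  qed
  have "(\<integral>\<^sup>+x. ennreal ((?S n x - L x)\<^sup>2) \<partial>M)
      = (\<integral>\<^sup>+x. liminf (\<lambda>k. ennreal ((?S n x - ?S (k + n) x)\<^sup>2)) \<partial>M)"
  proof (rule nn_integral_cong_AE, rule AE_mp[OF L(2)], intro AE_I2 impI)
    fix x assume "(\<lambda>n. ?S n x) \<longlonglongrightarrow> L x"
    then have "(\<lambda>k. ?S (k + n) x) \<longlonglongrightarrow> L x" by (rule LIMSEQ_ignore_initial_segment)
    then have "(\<lambda>k. ennreal ((?S n x - ?S (k + n) x)\<^sup>2)) \<longlonglongrightarrow> ennreal ((?S n x - L x)\<^sup>2)"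
      by (intro tendsto_intros) auto
    then show "ennreal ((?S n x - L x)\<^sup>2) = liminf (\<lambda>k. ennreal ((?S n x - ?S (k + n) x)\<^sup>2))"
      by (rule lim_imp_Liminf[OF trivial_limit_sequentially, symmetric])
  qed
  also have "\<dots> \<le> liminf (\<lambda>k. \<integral>\<^sup>+x. ennreal ((?S n x - ?S (k + n) x)\<^sup>2) \<partial>M)"
    by (rule nn_integral_liminf) measurable
  also have "\<dots> \<le> ennreal ?V"
    using Liminf_mono[of "\<lambda>k. \<integral>\<^sup>+x. ennreal ((?S n x - ?S (k + n) x)\<^sup>2) \<partial>M" "\<lambda>_. ennreal ?V" sequentially] fin
    by (simp add: Liminf_const)
  finally have le: "(\<integral>\<^sup>+x. ennreal ((?S n x - L x)\<^sup>2) \<partial>M) \<le> ennreal ?V" .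
  show int: "integrable M (\<lambda>x. (?S n x - L x)\<^sup>2)"
    using le by (intro integrableI_bounded) (auto simp: le_less_trans)
  show "expectation (\<lambda>x. (?S n x - L x)\<^sup>2) \<le> ?V"
    using le V0 by (subst (asm) nn_integral_eq_integral[OF int]) auto
qed

theorem L2_convergent_sum:
  assumes L: "L \<in> borel_measurable M" "AE x in M. (\<lambda>n. \<Sum>i<n. X i x) \<longlonglongrightarrow> L x"
  shows "integrable M (\<lambda>x. (L x)\<^sup>2)"
    and "(\<lambda>n. expectation (\<lambda>x. ((\<Sum>i<n. X i x) - L x)\<^sup>2)) \<longlonglongrightarrow> 0"
proof -
  \<comment> \<open>At \<open>n = 0\<close> the partial sum is empty, so the remainder is
    \<open>L\<close> up to sign.\<close>
  show "integrable M (\<lambda>x. (L x)\<^sup>2)"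
    using expectation_remainder_square(1)[OF L, of 0] by simp
  show "(\<lambda>n. expectation (\<lambda>x. ((\<Sum>i<n. X i x) - L x)\<^sup>2)) \<longlonglongrightarrow> 0"
  proof (rule tendsto_sandwich[where f="\<lambda>_. 0"])
    show "(\<lambda>n. \<Sum>i. expectation (\<lambda>x. (X (i + n) x)\<^sup>2)) \<longlonglongrightarrow> 0"
      by (rule suminf_exist_split2[OF summable_square])
    show "eventually (\<lambda>n. expectation (\<lambda>x. ((\<Sum>i<n. X i x) - L x)\<^sup>2)
        \<le> (\<Sum>i. expectation (\<lambda>x. (X (i + n) x)\<^sup>2))) sequentially"
      using expectation_remainder_square(2)[OF L] by simp
  qed auto
qed

end

section \<open>Mixing of shifts of i.i.d. fields\<close>

text \<open>For a fixed sequence \<open>C\<close>, the sets \<open>A\<close> with the asserted limit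
  form a Dynkin system. Taking \<open>A\<close> to be the whole space, which lies in
  \<open>G\<close>, identifies \<open>c\<close> as the limit of \<open>prob (C n)\<close>; this
  handles complements.\<close>

lemma (in prob_space) mixing_Dynkin:
  fixes C :: "nat \<Rightarrow> 'a set" and c :: real
  assumes G: "Int_stable G" "G \<subseteq> Pow (space M)" "sets M = sigma_sets (space M) G" "space M \<in> G"
    and C: "\<And>n. C n \<in> sets M"
    and base: "\<And>A. A \<in> G \<Longrightarrow> (\<lambda>n. prob (A \<inter> C n)) \<longlonglongrightarrow> prob A * c"
    and A: "A \<in> sets M"
  shows "(\<lambda>n. prob (A \<inter> C n)) \<longlonglongrightarrow> prob A * c"
proof -
  have Gs: "sigma_sets (space M) G = sets M" using G(3) by simp
  have lim_c: "(\<lambda>n. prob (C n)) \<longlonglongrightarrow> c"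
  proof -
    have "space M \<inter> C n = C n" for n using sets.sets_into_space[OF C] by auto
    then show ?thesis using base[OF G(4)] by (simp add: prob_space)
  qed
  have "A \<in> sigma_sets (space M) G" using A Gs by simp
  with G(1,2) show ?thesis
  proof (induction rule: sigma_sets_induct_disjoint)
    case (basic A)
    then show ?case by (rule base)
  next
    case empty
    show ?case by simp
  next
    case (compl A)
    then have A: "A \<in> sets M" by (simp add: Gs)
    have "prob ((space M - A) \<inter> C n) = prob (C n) - prob (A \<inter> C n)" for n
    proof -
      have "(space M - A) \<inter> C n = C n - A \<inter> C n" using sets.sets_into_space[OF C] by auto
      then show ?thesis using A C by (simp add: finite_measure_Diff)
    qed
    moreover have "prob (space M - A) * c = c - prob A * c"
      using A by (simp add: prob_compl algebra_simps)
    ultimately show ?case using tendsto_diff[OF lim_c compl.IH] by simp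
  next
    case (union A)
    then have A: "\<And>i. A i \<in> sets M" "range A \<subseteq> sets M" using Gs by auto
    have sums_A: "(\<lambda>i. prob (A i)) sums prob (\<Union>i. A i)"
      by (rule finite_measure_UNION[OF A(2) union.hyps(1)])
    have "(\<lambda>i. prob (A i \<inter> C n)) sums prob (\<Union>i. A i \<inter> C n)" for n
    proof (rule finite_measure_UNION)
      show "range (\<lambda>i. A i \<inter> C n) \<subseteq> sets M"
        using sets.Int[OF A(1) C] by blast
      show "disjoint_family (\<lambda>i. A i \<inter> C n)"
        by (rule disjoint_family_on_bisimulation[OF union.hyps(1)]) blast
    qed
    then have eq: "prob ((\<Union>i. A i) \<inter> C n) = (\<Sum>i. prob (A i \<inter> C n))" for n
      by (simp add: sums_iff)
    \<comment> \<open>Limit and infinite sum are exchanged by domination: \<open>prob (A i)\<close>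
      bounds the \<open>i\<close>-th term for every \<open>n\<close> and is summable.\<close>
    have "(\<lambda>n. \<Sum>i. prob (A i \<inter> C n)) \<longlonglongrightarrow> (\<Sum>i. prob (A i) * c)"
    proof (rule tannerys_theorem[THEN conjunct2, THEN conjunct2])
      show "summable (\<lambda>i. prob (A i))" using sums_A by (rule sums_summable)
      show "eventually (\<lambda>(i, n). norm (prob (A i \<inter> C n)) \<le> prob (A i)) (at_top \<times>\<^sub>F sequentially)"
        using A C by (intro always_eventually) (auto intro!: finite_measure_mono)
    qed (use union.IH in auto)
    also have "(\<Sum>i. prob (A i) * c) = prob (\<Union>i. A i) * c"
      using sums_mult2[OF sums_A, of c] by (simp add: sums_iff)
    finally show ?case by (simp add: eq)
  qed
qed

definition translate :: "'g::ab_group_add \<Rightarrow> ('g \<Rightarrow> 'b) \<Rightarrow> 'g \<Rightarrow> 'b" where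
  "translate h f = (\<lambda>g. f (g + h))"

lemma translate_0 [simp]: "translate 0 f = f"
  by (simp add: translate_def)

lemma translate_translate: "translate h (translate k f) = translate (h + k) f"
  by (simp add: translate_def add.assoc)

section \<open>Translations of product measures\<close>

locale iid_field = prob_space \<nu> for \<nu> :: "'b measure"
begin

abbreviation field_law :: "('g::ab_group_add \<Rightarrow> 'b) measure" where
  "field_law \<equiv> PiM UNIV (\<lambda>_. \<nu>)"

sublocale product: product_prob_space "\<lambda>_::'g::ab_group_add. \<nu>" UNIV
  by unfold_locales

lemma measurable_translate [measurable]: "translate h \<in> measurable field_law field_law"
  unfolding translate_def by (rule measurable_PiM_single') (auto simp: space_PiM)

lemma distr_translate: "distr field_law field_law (translate h) = field_law"
  using distr_PiM_reindex[of UNIV "\<lambda>_. \<nu>" "\<lambda>g. g + h" UNIV] prob_space_axioms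
  by (simp add: translate_def[abs_def] inj_on_def restrict_def)

lemma translate_space: "f \<in> space field_law \<Longrightarrow> translate h f \<in> space field_law"
  using measurable_translate by (rule measurable_space)

lemma measure_translate_vimage:
  assumes "A \<in> sets field_law"
  shows "measure field_law (translate h -` A \<inter> space field_law) = measure field_law A"
proof -
  have "measure field_law A = measure (distr field_law field_law (translate h)) A"
    by (simp only: distr_translate)
  then show ?thesis using assms by (simp add: measure_distr)
qed

lemma measure_box:
  assumes "finite J" "\<And>j. j \<in> J \<Longrightarrow> E j \<in> sets \<nu>"
  shows "measure field_law {f \<in> space field_law. \<forall>j\<in>J. f j \<in> E j} = (\<Prod>j\<in>J. measure \<nu> (E j))"
proof -
  have "{f \<in> space field_law. \<forall>j\<in>J. f j \<in> E j} = prod_emb UNIV (\<lambda>_. \<nu>) J (Pi\<^sub>E J E)"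
    by (auto simp: prod_emb_def space_PiM)
  then show ?thesis using assms by (simp add: product.measure_PiM_emb)
qed

lemma box_ex:
  assumes "A \<in> prod_algebra UNIV (\<lambda>_::'g::ab_group_add. \<nu>)"
  shows "\<exists>J E. finite J \<and> (\<forall>j\<in>J. E j \<in> sets \<nu>) \<and> A = {f \<in> space field_law. \<forall>j\<in>J. f j \<in> E j}"
proof (rule prod_algebraE[OF assms])
  fix J E assume "A = prod_emb UNIV (\<lambda>_. \<nu>) J (Pi\<^sub>E J E)" "finite J" "\<And>i. i \<in> J \<Longrightarrow> E i \<in> sets \<nu>"
  then show ?thesis by (intro exI[of _ J] exI[of _ E]) (auto simp: prod_emb_def space_PiM)
qed

text \<open>A box reads finitely many coordinates. Once the shift separates the two coordinate sets,
  the intersection is again a box and its measure factors exactly.\<close>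

lemma mixing_boxes:
  fixes h :: "nat \<Rightarrow> 'g::ab_group_add"
  assumes "inj h" "A \<in> prod_algebra UNIV (\<lambda>_::'g. \<nu>)" "B \<in> prod_algebra UNIV (\<lambda>_::'g. \<nu>)"
  shows "(\<lambda>n. measure field_law (A \<inter> (translate (h n) -` B \<inter> space field_law)))
    \<longlonglongrightarrow> measure field_law A * measure field_law B"
proof -
  obtain J E where J: "finite J" "\<And>j. j \<in> J \<Longrightarrow> E j \<in> sets \<nu>"
    and A: "A = {f \<in> space field_law. \<forall>j\<in>J. f j \<in> E j}" using box_ex[OF assms(2)] by auto
  obtain K F where K: "finite K" "\<And>j. j \<in> K \<Longrightarrow> F j \<in> sets \<nu>"
    and B: "B = {f \<in> space field_law. \<forall>j\<in>K. f j \<in> F j}" using box_ex[OF assms(3)] by auto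
  \<comment> \<open>The coordinate sets meet only if the shift is one of finitely many differences,
    and injectivity lets each difference occur for at most one \<open>n\<close>.\<close>
  have "finite {n. h n \<in> (\<lambda>(j, k). j - k) ` (J \<times> K)}"
    using finite_vimageI[OF _ assms(1), of "(\<lambda>(j, k). j - k) ` (J \<times> K)"] J(1) K(1) by (simp add: vimage_def)
  then have "eventually (\<lambda>n. h n \<notin> (\<lambda>(j, k). j - k) ` (J \<times> K)) sequentially"
    by (simp add: eventually_cofinite flip: cofinite_eq_sequentially)
  then have "eventually (\<lambda>n. measure field_law (A \<inter> (translate (h n) -` B \<inter> space field_law))
      = measure field_law A * measure field_law B) sequentially"
  proof eventually_elim
    case (elim n)
    let ?K = "(\<lambda>k. k + h n) ` K"
    let ?E = "\<lambda>i. if i \<in> J then E i else F (i - h n)"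
    have disj: "k + h n \<notin> J" if "k \<in> K" for k
    proof
      assume "k + h n \<in> J"
      then have "h n \<in> (\<lambda>(j, k). j - k) ` (J \<times> K)"
        using that by (intro image_eqI[of _ _ "(k + h n, k)"]) auto
      with elim show False by simp
    qed
    have "A \<inter> (translate (h n) -` B \<inter> space field_law) = {f \<in> space field_law. \<forall>i\<in>J \<union> ?K. f i \<in> ?E i}"
    proof -
      have "(\<forall>i\<in>J \<union> ?K. f i \<in> ?E i) \<longleftrightarrow> (\<forall>j\<in>J. f j \<in> E j) \<and> (\<forall>k\<in>K. f (k + h n) \<in> F k)"
        for f
        using disj by (simp add: ball_Un)
      then show ?thesis
        using translate_space[of _ "h n"] unfolding A B by (auto simp: translate_def)
    qed
    then have "measure field_law (A \<inter> (translate (h n) -` B \<inter> space field_law))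
        = (\<Prod>i\<in>J \<union> ?K. measure \<nu> (?E i))"
      using J K disj by (simp only:) (subst measure_box, auto)
    also have "\<dots> = (\<Prod>i\<in>J. measure \<nu> (?E i)) * (\<Prod>i\<in>?K. measure \<nu> (?E i))"
      by (rule prod.union_disjoint) (use J(1) K(1) disj in auto)
    also have "(\<Prod>i\<in>?K. measure \<nu> (?E i)) = (\<Prod>k\<in>K. measure \<nu> (F k))"
      by (subst prod.reindex) (use disj in \<open>auto simp: inj_on_def intro!: prod.cong\<close>)
    also have "(\<Prod>i\<in>J. measure \<nu> (?E i)) = (\<Prod>i\<in>J. measure \<nu> (E i))" by simp
    finally show ?case unfolding A B by (simp only: measure_box[OF J] measure_box[OF K])
  qed
  then show ?thesis by (rule tendsto_eventually)
qed

text \<open>With the shifted set still a box, the first Dynkin extension makes \<open>A\<close>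
  arbitrary. After exchanging roles, a second one makes \<open>B\<close> arbitrary.\<close>

theorem mixing:
  fixes h :: "nat \<Rightarrow> 'g::ab_group_add"
  assumes inj: "inj h" and A: "A \<in> sets (field_law :: ('g \<Rightarrow> 'b) measure)" and B: "B \<in> sets field_law"
  shows "(\<lambda>n. measure field_law (A \<inter> (translate (h n) -` B \<inter> space field_law)))
    \<longlonglongrightarrow> measure field_law A * measure field_law B"
proof -
  note dynkin = product.P.mixing_Dynkin[OF Int_stable_prod_algebra
      prod_algebra_sets_into_space[folded space_PiM] sets_PiM[folded space_PiM]
      space_in_prod_algebra[folded space_PiM]]
  have prod_sets: "C \<in> sets field_law" if "C \<in> prod_algebra UNIV (\<lambda>_::'g. \<nu>)" for C
    using that by (simp add: sets_PiM sigma_sets.Basic)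
  have vimage_sets: "translate k -` C \<inter> space field_law \<in> sets field_law"
    if "C \<in> sets field_law" for C and k :: 'g
    using that by (rule measurable_sets[OF measurable_translate])
  \<comment> \<open>Applying the measure-preserving translation by \<open>- k\<close> moves the
    shift from \<open>C\<close> to \<open>A\<close>, leaving \<open>C\<close> fixed as the Dynkin
    lemma requires.\<close>
  have swap: "measure field_law (A \<inter> (translate k -` C \<inter> space field_law))
      = measure field_law (C \<inter> (translate (- k) -` A \<inter> space field_law))"
    if C: "C \<in> sets field_law" for C and k :: 'g
  proof -
    have AC: "A \<inter> (translate k -` C \<inter> space field_law) \<in> sets field_law"
      using A vimage_sets[OF C] by blast
    have "translate (- k) -` (A \<inter> (translate k -` C \<inter> space field_law)) \<inter> space field_law
        = C \<inter> (translate (- k) -` A \<inter> space field_law)"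
      using sets.sets_into_space[OF C] translate_space[of _ "- k"] by (auto simp: translate_translate)
    with measure_translate_vimage[OF AC, of "- k"] show ?thesis by simp
  qed
  have half: "(\<lambda>n. measure field_law (A \<inter> (translate (h n) -` C \<inter> space field_law)))
      \<longlonglongrightarrow> measure field_law A * measure field_law C"
    if "C \<in> prod_algebra UNIV (\<lambda>_. \<nu>)" for C
    by (rule dynkin) (auto intro: mixing_boxes[OF inj] that A vimage_sets prod_sets)
  have "(\<lambda>n. measure field_law (B \<inter> (translate (- h n) -` A \<inter> space field_law)))
      \<longlonglongrightarrow> measure field_law B * measure field_law A"
  proof (rule dynkin)
    fix C assume C: "C \<in> prod_algebra UNIV (\<lambda>_::'g. \<nu>)"
    show "(\<lambda>n. measure field_law (C \<inter> (translate (- h n) -` A \<inter> space field_law)))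
        \<longlonglongrightarrow> measure field_law C * measure field_law A"
      using half[OF C] by (simp add: swap[OF prod_sets[OF C]] mult.commute)
  qed (auto intro: vimage_sets A B)
  then show ?thesis by (simp add: swap[OF B] mult.commute)
qed

text \<open>Mixing of an invariant set with itself gives a measure equal to its own square. The
  iterate \<open>((+) h ^^ n) 0\<close> is the multiple \<open>n h\<close> in a general group, so
  the injectivity assumption says that \<open>h\<close> has infinite order.\<close>

corollary translate_ergodic:
  fixes h :: "'g::ab_group_add"
  assumes inj: "inj (\<lambda>n::nat. ((+) h ^^ n) 0)" and A: "A \<in> sets (field_law :: ('g \<Rightarrow> 'b) measure)"
    and fix_A: "translate h -` A \<inter> space field_law = A"
  shows "measure field_law A = 0 \<or> measure field_law A = 1"
proof -
  have fix_n: "translate (((+) h ^^ n) 0) -` A \<inter> space field_law = A" for n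
  proof (induction n)
    case 0
    show ?case using sets.sets_into_space[OF A] by auto
  next
    case (Suc n)
    have "translate (((+) h ^^ Suc n) 0) f = translate (((+) h ^^ n) 0) (translate h f)" for f :: "'g \<Rightarrow> 'b"
      by (simp add: translate_translate add.commute)
    then have "translate (((+) h ^^ Suc n) 0) -` A \<inter> space field_law
        = translate h -` (translate (((+) h ^^ n) 0) -` A \<inter> space field_law) \<inter> space field_law"
      using translate_space[of _ h] by auto
    then show ?case by (simp only: Suc fix_A)
  qed
  have "(\<lambda>n::nat. measure field_law A) \<longlonglongrightarrow> measure field_law A * measure field_law A"
    using mixing[OF inj A A] by (simp only: fix_n Int_absorb)
  then have "measure field_law A = measure field_law A * measure field_law A"
    by (rule LIMSEQ_unique[OF tendsto_const])
  then show ?thesis by simp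
qed

end

section \<open>The increment field\<close>

lemma borel_measurable_vec_lambda:
  fixes f :: "'d::finite \<Rightarrow> 'a \<Rightarrow> real"
  assumes "\<And>i. f i \<in> borel_measurable N"
  shows "(\<lambda>\<omega>. \<chi> i. f i \<omega>) \<in> borel_measurable N"
  by (subst borel_measurable_euclidean_space) (use assms in \<open>auto simp: Basis_vec_def inner_axis\<close>)

section \<open>Algebra, measurability and equivariance of the increments\<close>

context walk_kernel
begin

lemma noise_sum_eq:
  "(\<Sum>\<^sub>\<infinity>z. a z * (trans_pow p k y z - trans_pow p k x z))
    = (\<Sum>z | trans_pow p k y z - trans_pow p k x z \<noteq> 0. a z * (trans_pow p k y z - trans_pow p k x z))"
  by (rule infsum_eq_sum_support[OF finite_diff_support]) auto

text \<open>Only noise at times \<open>t - k\<close> is read. Restricting the assumption to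
  \<open>s \<le> t\<close> records this causality, which independence from the next innovation
  relies on.\<close>

lemma Delta_partial_measurable:
  assumes "\<And>s z. s \<le> t \<Longrightarrow> \<xi> s z \<in> borel_measurable N"
  shows "(\<lambda>\<omega>. Delta_partial p \<xi> n t x y \<omega>) \<in> borel_measurable N"
  unfolding Delta_partial_def noise_sum_eq
  by (intro borel_measurable_sum borel_measurable_times borel_measurable_const assms) simp

lemma Delta_measurable:
  assumes "\<And>s z. s \<le> t \<Longrightarrow> \<xi> s z \<in> borel_measurable N"
  shows "Delta p \<xi> t x y \<in> borel_measurable N"
proof -
  have "(\<lambda>\<omega>. Delta p \<xi> t x y \<omega>) \<in> borel_measurable N"
    unfolding Delta_def by (intro borel_measurable_lim_metric Delta_partial_measurable assms)
  then show ?thesis .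
qed

lemma Delta_vec_measurable:
  assumes "\<And>s z. s \<le> t \<Longrightarrow> \<xi> s z \<in> borel_measurable N"
  shows "Delta_vec p \<xi> t x \<in> borel_measurable N"
proof -
  have "(\<lambda>\<omega>. Delta_vec p \<xi> t x \<omega>) \<in> borel_measurable N"
    unfolding Delta_vec_def by (intro borel_measurable_vec_lambda Delta_measurable assms)
  then show ?thesis .
qed

lemma Delta_partial_additive:
  "Delta_partial p \<xi> n t x y \<omega> + Delta_partial p \<xi> n t y z \<omega> = Delta_partial p \<xi> n t x z \<omega>"
proof -
  have sm: "(\<lambda>w. a w * (trans_pow p k x' w - trans_pow p k y' w)) summable_on UNIV" for a k x' y'
    by (rule finite_support_summable_on) (rule finite_subset[OF _ finite_diff_support[of k x' y']], auto)
  show ?thesis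
    unfolding Delta_partial_def sum.distrib[symmetric]
    by (intro sum.cong refl, subst infsum_add[OF sm sm, symmetric])
       (simp add: algebra_simps)
qed

text \<open>At time \<open>t + 1\<close> the term \<open>k = 0\<close> is the fresh noise. The term
  \<open>k + 1\<close> reads noise at time \<open>t - k\<close>, and its first step averages the
  \<open>k\<close>-th terms at time \<open>t\<close>; hence \<open>Suc n\<close> terms on the left
  match \<open>n\<close> on the right.\<close>

lemma Delta_partial_Suc:
  "Delta_partial p \<xi> (Suc n) (t + 1) x y \<omega> =
     (\<Sum>z | p z \<noteq> 0. p z * Delta_partial p \<xi> n t (x + z) (y + z) \<omega>) + \<xi> (t + 1) y \<omega> - \<xi> (t + 1) x \<omega>"
proof -
  let ?S = "{z. p z \<noteq> 0}"
  let ?D = "\<lambda>k x y z. trans_pow p k y z - trans_pow p k x z"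
  have step: "(\<Sum>\<^sub>\<infinity>z. a z * ?D (Suc k) x y z) = (\<Sum>w\<in>?S. p w * (\<Sum>\<^sub>\<infinity>z. a z * ?D k (x + w) (y + w) z))" for a k
  proof -
    let ?B = "\<Union>w\<in>?S. {z. ?D k (x + w) (y + w) z \<noteq> 0}"
    have B: "finite ?B" by (rule finite_UN_I[OF finite_support finite_diff_support])
    have D: "?D (Suc k) x y z = (\<Sum>w\<in>?S. p w * ?D k (x + w) (y + w) z)" for z
      by (simp only: trans_pow_Suc right_diff_distrib sum_subtractf)
    have "(\<Sum>\<^sub>\<infinity>z. a z * ?D (Suc k) x y z) = (\<Sum>z\<in>?B. a z * ?D (Suc k) x y z)"
    proof (rule infsum_eq_sum_support[OF B])
      fix z assume z: "z \<notin> ?B"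
      have "p w * ?D k (x + w) (y + w) z = 0" if "w \<in> ?S" for w using z that by auto
      then have "?D (Suc k) x y z = 0" unfolding D by (rule sum.neutral[OF ballI])
      then show "a z * ?D (Suc k) x y z = 0" by (simp only: mult_zero_right)
    qed
    also have "\<dots> = (\<Sum>w\<in>?S. p w * (\<Sum>z\<in>?B. a z * ?D k (x + w) (y + w) z))"
      unfolding D sum_distrib_left by (subst sum.swap) (simp only: mult.left_commute)
    also have "\<dots> = (\<Sum>w\<in>?S. p w * (\<Sum>\<^sub>\<infinity>z. a z * ?D k (x + w) (y + w) z))"
    proof (intro sum.cong refl arg_cong2[where f="(*)"] infsum_eq_sum_support[OF B, symmetric])
      fix w z assume "w \<in> ?S" "z \<notin> ?B"
      then have "?D k (x + w) (y + w) z = 0" by auto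
      then show "a z * ?D k (x + w) (y + w) z = 0" by (simp only: mult_zero_right)
    qed
    finally show ?thesis .
  qed
  have first: "(\<Sum>\<^sub>\<infinity>z. a z * ?D 0 x y z) = a y - a x" for a :: "int^'d \<Rightarrow> real"
    by (subst infsum_eq_sum_support[of "{x, y}"]) (auto, cases "x = y", auto)
  have "Delta_partial p \<xi> (Suc n) (t + 1) x y \<omega>
      = (\<xi> (t + 1) y \<omega> - \<xi> (t + 1) x \<omega>) + (\<Sum>k<n. \<Sum>\<^sub>\<infinity>z. \<xi> (t - int k) z \<omega> * ?D (Suc k) x y z)"
    unfolding Delta_partial_def sum.lessThan_Suc_shift first by (simp del: trans_pow.simps)
  also have "(\<Sum>k<n. \<Sum>\<^sub>\<infinity>z. \<xi> (t - int k) z \<omega> * ?D (Suc k) x y z)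
      = (\<Sum>z\<in>?S. p z * Delta_partial p \<xi> n t (x + z) (y + z) \<omega>)"
    unfolding step Delta_partial_def sum_distrib_left by (rule sum.swap)
  finally show ?thesis by simp
qed

text \<open>The limit passes through the average because only finitely many \<open>z\<close> carry
  weight.\<close>

lemma Delta_evolution:
  assumes "\<And>t x y. convergent (\<lambda>n. Delta_partial p \<xi> n t x y \<omega>)"
  shows "Delta p \<xi> (t + 1) x y \<omega>
    = (\<Sum>\<^sub>\<infinity>z. p z * Delta p \<xi> t (x + z) (y + z) \<omega>) + \<xi> (t + 1) y \<omega> - \<xi> (t + 1) x \<omega>"
proof -
  have lim: "(\<lambda>n. Delta_partial p \<xi> n t x y \<omega>) \<longlonglongrightarrow> Delta p \<xi> t x y \<omega>" for t x y
    using assms unfolding Delta_def by (simp add: convergent_LIMSEQ_iff)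
  have "(\<lambda>n. Delta_partial p \<xi> (Suc n) (t + 1) x y \<omega>) \<longlonglongrightarrow>
     (\<Sum>z | p z \<noteq> 0. p z * Delta p \<xi> t (x + z) (y + z) \<omega>) + \<xi> (t + 1) y \<omega> - \<xi> (t + 1) x \<omega>"
    unfolding Delta_partial_Suc by (intro tendsto_intros lim)
  then show ?thesis
    unfolding infsum_kernel using LIMSEQ_Suc[OF lim] LIMSEQ_unique by blast
qed

lemma Delta_additive:
  assumes "\<And>t x y. convergent (\<lambda>n. Delta_partial p \<xi> n t x y \<omega>)"
  shows "Delta p \<xi> t x y \<omega> + Delta p \<xi> t y z \<omega> = Delta p \<xi> t x z \<omega>"
proof -
  have lim: "(\<lambda>n. Delta_partial p \<xi> n t x y \<omega>) \<longlonglongrightarrow> Delta p \<xi> t x y \<omega>" for t x y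
    using assms unfolding Delta_def by (simp add: convergent_LIMSEQ_iff)
  show ?thesis
    using tendsto_add[OF lim[of t x y] lim[of t y z]] lim[of t x z] LIMSEQ_unique
    unfolding Delta_partial_additive by blast
qed

text \<open>The increments as a function of the noise: the sample point of \<^const>\<open>Delta_vec\<close> is the
  noise configuration itself.\<close>

definition Delta_field :: "(int \<times> (int^'d) \<Rightarrow> real) \<Rightarrow> int \<times> (int^'d) \<Rightarrow> real^'d" where
  "Delta_field w = (\<lambda>(s, y). Delta_vec p (\<lambda>s y w. w (s, y)) s y w)"

text \<open>The partial sums already agree term by term after reindexing \<open>z\<close>, so their
  \<open>lim\<close> values agree for every configuration, convergent or not.\<close>

lemma Delta_field_shift: "Delta_field (translate (t, x) w) = st_shift x t (Delta_field w)"
proof -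
  let ?c = "\<lambda>s y w. w (s, y) :: real"
  have "Delta_partial p ?c n s y y' (translate (t, x) w) = Delta_partial p ?c n (s + t) (y + x) (y' + x) w"
    for n s y y'
    unfolding Delta_partial_def
  proof (rule sum.cong[OF refl])
    fix k
    let ?g = "\<lambda>z. w (s + t - int k, z) * (trans_pow p k (y' + x) z - trans_pow p k (y + x) z)"
    have "infsum ?g UNIV = (\<Sum>\<^sub>\<infinity>z. ?g (z + x))"
      by (rule infsum_reindex_bij_betw[OF bij_plus_right, symmetric])
    then show "(\<Sum>\<^sub>\<infinity>z. translate (t, x) w (s - int k, z) * (trans_pow p k y' z - trans_pow p k y z))
        = infsum ?g UNIV"
      by (simp add: translate_def trans_pow_translate add_diff_eq diff_add_eq)
  qed
  then have "Delta p ?c s y y' (translate (t, x) w) = Delta p ?c (s + t) (y + x) (y' + x) w" for s y y'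
    by (simp add: Delta_def)
  then show ?thesis
    by (auto simp: Delta_field_def st_shift_def Delta_vec_def fun_eq_iff vec_eq_iff algebra_simps)
qed

text \<open>\<open>N\<close> stays general because the map is used both on the Borel product and on
  the product of copies of the noise law, whose sigma-algebras coincide.\<close>

lemma Delta_field_measurable:
  assumes N: "sets N = sets (PiM UNIV (\<lambda>_. borel))"
  shows "Delta_field \<in> measurable N (PiM UNIV (\<lambda>_. borel))"
proof (rule measurable_PiM_single')
  fix i :: "int \<times> (int^'d)"
  have c: "(\<lambda>w. w j) \<in> borel_measurable N" for j :: "int \<times> (int^'d)"
    by (simp add: measurable_cong_sets[OF N refl])
  show "(\<lambda>w. Delta_field w i) \<in> borel_measurable N"
    using Delta_vec_measurable[of "fst i" "\<lambda>s y w. w (s, y)" N "snd i"] c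
    by (simp add: Delta_field_def case_prod_beta)
qed simp

end

text \<open>The space-time lattice is torsion-free: some coordinate of \<open>h\<close> is nonzero,
  and its integer multiples are distinct.\<close>

lemma translate_orbit_inj:
  fixes h :: "int \<times> (int^'d)"
  assumes "h \<noteq> 0"
  shows "inj (\<lambda>n::nat. ((+) h ^^ n) 0)"
proof -
  have eq: "((+) h ^^ n) 0 = (int n * fst h, \<chi> i. int n * (snd h $ i))" for n
    by (induction n) (auto simp: prod_eq_iff vec_eq_iff algebra_simps zero_vec_def zero_prod_def)
  have "fst h \<noteq> 0 \<or> (\<exists>i. snd h $ i \<noteq> 0)"
    using assms by (auto simp: prod_eq_iff vec_eq_iff)
  then show ?thesis
    unfolding eq by (auto simp: inj_def vec_eq_iff)
qed

section \<open>The increment series driven by i.i.d. noise\<close>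

locale noise_field = walk_kernel p + prob_space M
  for p :: "int^'d \<Rightarrow> real" and M :: "'w measure" +
  fixes \<xi> :: "int \<Rightarrow> int^'d \<Rightarrow> 'w \<Rightarrow> real"
  assumes xi_indep: "indep_vars (\<lambda>_. borel) (\<lambda>(t, x). \<xi> t x) UNIV"
    and xi_ident: "distr M borel (\<xi> t x) = distr M borel (\<xi> 0 0)"
    and xi_square: "integrable M (\<lambda>\<omega>. (\<xi> 0 0 \<omega>)\<^sup>2)"
    and xi_mean: "expectation (\<xi> 0 0) = 0"
begin

lemma xi_measurable [measurable]: "\<xi> t x \<in> borel_measurable M"
  using xi_indep by (force simp: indep_vars_def)

lemma xi_integral: "f \<in> borel_measurable borel \<Longrightarrow> expectation (\<lambda>\<omega>. f (\<xi> t x \<omega>) :: real) = expectation (\<lambda>\<omega>. f (\<xi> 0 0 \<omega>))"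
  using integral_distr[of "\<xi> t x" M borel f] integral_distr[of "\<xi> 0 0" M borel f] xi_ident[of t x] by simp

lemma xi_square_integrable: "integrable M (\<lambda>\<omega>. (\<xi> t x \<omega>)\<^sup>2)"
  using xi_square integrable_distr_eq[of "\<xi> t x" M borel "\<lambda>u. u\<^sup>2"]
    integrable_distr_eq[of "\<xi> 0 0" M borel "\<lambda>u. u\<^sup>2"] xi_ident[of t x] by simp

lemma xi_integrable: "integrable M (\<xi> t x)"
  by (rule integrable_of_square) (auto intro: xi_square_integrable)

lemma xi_centered: "expectation (\<xi> t x) = 0"
  using xi_integral[of "\<lambda>u. u" t x] xi_mean by simp

lemma xi_orthogonal:
  assumes "(s, x) \<noteq> (t, y)"
  shows "expectation (\<lambda>\<omega>. \<xi> s x \<omega> * \<xi> t y \<omega>) = 0"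
  using indep_vars_orthogonal[OF xi_indep, of "(s, x)" "(t, y)"] assms
  by (auto simp: xi_integrable xi_centered)

text \<open>Orthogonality of the noise within one time slice makes the \<open>k\<close>-th variance
  a constant multiple of \<open>trans_dist k y x\<close>, which is summable by the energy
  argument.\<close>

lemma increments_summable:
  "indep_centered_summable M
    (\<lambda>k \<omega>. \<Sum>\<^sub>\<infinity>z. \<xi> (t - int k) z \<omega> * (trans_pow p k y z - trans_pow p k x z))"
proof -
  define c where "c k z = trans_pow p k y z - trans_pow p k x z" for k z
  let ?D = "\<lambda>k. {z. c k z \<noteq> 0}"
  let ?X = "\<lambda>k \<omega>. \<Sum>z\<in>?D k. \<xi> (t - int k) z \<omega> * c k z"
  have fin: "finite (?D k)" for k unfolding c_def by (rule finite_diff_support)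
  have X_eq: "(\<Sum>\<^sub>\<infinity>z. \<xi> (t - int k) z \<omega> * (trans_pow p k y z - trans_pow p k x z)) = ?X k \<omega>" for k \<omega>
    unfolding c_def by (rule noise_sum_eq)
  have orth: "expectation (\<lambda>\<omega>. (\<xi> (t - int k) v \<omega> * c k v) * (\<xi> (t - int k) w \<omega> * c k w)) = 0"
    if "v \<noteq> w" for k v w
  proof -
    have "expectation (\<lambda>\<omega>. (\<xi> (t - int k) v \<omega> * c k v) * (\<xi> (t - int k) w \<omega> * c k w))
        = expectation (\<lambda>\<omega>. (c k v * c k w) * (\<xi> (t - int k) v \<omega> * \<xi> (t - int k) w \<omega>))"
      by (simp only: mult_ac)
    also have "\<dots> = 0"
      using that by (simp add: xi_orthogonal)
    finally show ?thesis .
  qed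
  have square: "integrable M (\<lambda>\<omega>. (?X k \<omega>)\<^sup>2)"
    "expectation (\<lambda>\<omega>. (?X k \<omega>)\<^sup>2) = (\<Sum>z\<in>?D k. expectation (\<lambda>\<omega>. (\<xi> (t - int k) z \<omega> * c k z)\<^sup>2))" for k
    by (rule orthogonal_sum_square[OF fin];
        (intro orth)?; simp add: power_mult_distrib xi_square_integrable)+
  have "expectation (\<lambda>\<omega>. (?X k \<omega>)\<^sup>2) = expectation (\<lambda>\<omega>. (\<xi> 0 0 \<omega>)\<^sup>2) * trans_dist k y x" for k
  proof -
    have "expectation (\<lambda>\<omega>. (?X k \<omega>)\<^sup>2) = (\<Sum>z\<in>?D k. expectation (\<lambda>\<omega>. (\<xi> 0 0 \<omega>)\<^sup>2) * (c k z)\<^sup>2)"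
      unfolding square(2)
      using xi_integral[of "\<lambda>u. u\<^sup>2"] by (intro sum.cong refl) (simp add: power_mult_distrib)
    also have "(\<Sum>z\<in>?D k. expectation (\<lambda>\<omega>. (\<xi> 0 0 \<omega>)\<^sup>2) * (c k z)\<^sup>2) = expectation (\<lambda>\<omega>. (\<xi> 0 0 \<omega>)\<^sup>2) * trans_dist k y x"
      unfolding trans_dist_def sum_distrib_left[symmetric] c_def[symmetric]
      by (subst infsum_eq_sum_support[OF fin[of k]]) auto
    finally show ?thesis .
  qed
  then have "summable (\<lambda>k. expectation (\<lambda>\<omega>. (?X k \<omega>)\<^sup>2))"
    by (simp add: summable_mult summable_trans_dist)
  moreover have "indep_vars (\<lambda>_. borel) ?X UNIV"
  proof -
    \<comment> \<open>The \<open>k\<close>-th term reads only the time slice \<open>t - k\<close>;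
      slices for different \<open>k\<close> are disjoint, so the terms are independent.\<close>
    let ?K = "\<lambda>k. {t - int k} \<times> (UNIV :: (int^'d) set)"
    have "indep_vars (\<lambda>_. borel) (\<lambda>k \<omega>. (\<lambda>f. \<Sum>z\<in>?D k. f (t - int k, z) * c k z)
        (restrict (\<lambda>i. (\<lambda>(t, x). \<xi> t x) i \<omega>) (?K k))) UNIV"
      by (rule indep_vars_compose2[OF indep_vars_restrict[OF xi_indep]])
         (auto simp: disjoint_family_on_def intro!: borel_measurable_sum borel_measurable_times measurable_component_singleton)
    then show ?thesis by simp
  qed
  moreover have "expectation (?X k) = 0" for k
    by (simp add: xi_integrable xi_centered)
  ultimately show ?thesis
    unfolding X_eq using square(1) by unfold_locales auto
qed

lemma AE_convergent: "AE \<omega> in M. \<forall>t x y. convergent (\<lambda>n. Delta_partial p \<xi> n t x y \<omega>)"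
  unfolding AE_all_countable Delta_partial_def
  using indep_centered_summable.AE_convergent_sum[OF increments_summable] by blast

lemma AE_tendsto: "AE \<omega> in M. (\<lambda>n. Delta_partial p \<xi> n t x y \<omega>) \<longlonglongrightarrow> Delta p \<xi> t x y \<omega>"
  using AE_convergent by (rule AE_mp) (auto simp: Delta_def convergent_LIMSEQ_iff)

lemma Delta_random_variable: "Delta p \<xi> t x y \<in> borel_measurable M"
  by (rule Delta_measurable) simp

lemma Delta_square_integrable: "integrable M (\<lambda>\<omega>. (Delta p \<xi> t x y \<omega>)\<^sup>2)"
  and Delta_L2_limit: "(\<lambda>n. \<integral>\<omega>. (Delta_partial p \<xi> n t x y \<omega> - Delta p \<xi> t x y \<omega>)\<^sup>2 \<partial>M) \<longlonglongrightarrow> 0"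
  using indep_centered_summable.L2_convergent_sum[OF increments_summable Delta_random_variable
      AE_tendsto[unfolded Delta_partial_def]]
  unfolding Delta_partial_def by blast+

text \<open>Two disjoint blocks of noise indices, time \<open>t + 1\<close> and times up to
  \<open>t\<close>, generate independent sigma-algebras. By causality the whole past of the
  increments is measurable for the second block, and the innovation for the first.\<close>

lemma innovation_indep:
  "indep_set
    (sets (vimage_algebra (space M) (\<lambda>\<omega> x. \<xi> (t + 1) x \<omega>) (Pi\<^sub>M UNIV (\<lambda>_. borel))))
    (sets (vimage_algebra (space M) (\<lambda>\<omega> (n::nat, x). Delta_vec p \<xi> (t - int n) x \<omega>) (Pi\<^sub>M UNIV (\<lambda>_. borel))))"
proof -
  let ?xi = "\<lambda>(t, x). \<xi> t x"
  let ?E = "\<lambda>i. {?xi i -` A \<inter> space M | A. A \<in> sets borel}"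
  let ?I = "case_bool ({t + 1} \<times> UNIV) ({..t} \<times> UNIV) :: bool \<Rightarrow> (int \<times> (int^'d)) set"
  let ?N = "\<lambda>j. sigma (space M) (\<Union>i\<in>?I j. ?E i)"
  have sub: "(\<Union>i\<in>?I j. ?E i) \<subseteq> Pow (space M)" for j by auto
  have ind: "indep_sets (\<lambda>j. sets (?N j)) UNIV"
    unfolding sets_measure_of[OF sub]
  proof (rule indep_sets_collect_sigma)
    have "indep_sets ?E UNIV" using xi_indep unfolding indep_vars_def2 by blast
    then show "indep_sets ?E (\<Union>j. ?I j)" by (rule indep_sets_mono_index[rotated]) simp
    show "Int_stable (?E i)" for i
    proof (rule Int_stableI)
      fix a b assume "a \<in> ?E i" "b \<in> ?E i"
      then obtain A B where "A \<in> sets borel" "B \<in> sets borel" "a = ?xi i -` A \<inter> space M" "b = ?xi i -` B \<inter> space M"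
        by blast
      then show "a \<inter> b \<in> ?E i" by (intro CollectI exI[of _ "A \<inter> B"]) auto
    qed
    show "disjoint_family_on ?I UNIV"
      by (auto simp: disjoint_family_on_def split: bool.splits)
  qed
  have meas: "\<xi> s z \<in> borel_measurable (?N j)" if "(s, z) \<in> ?I j" for s z j
  proof (rule measurableI)
    fix A :: "real set" assume "A \<in> sets borel"
    then have "\<xi> s z -` A \<inter> space M \<in> (\<Union>i\<in>?I j. ?E i)"
      using that by (intro UN_I[of "(s, z)"]) auto
    then show "\<xi> s z -` A \<inter> space (?N j) \<in> sets (?N j)"
      unfolding sets_measure_of[OF sub] space_measure_of[OF sub] by (rule sigma_sets.Basic)
  qed simp
  have now: "sets (vimage_algebra (space M) (\<lambda>\<omega> x. \<xi> (t + 1) x \<omega>) (Pi\<^sub>M UNIV (\<lambda>_. borel))) \<subseteq> sets (?N True)"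
  proof (rule sets_image_in_sets)
    have "\<xi> (t + 1) x \<in> borel_measurable (?N True)" for x
      by (rule meas) simp
    then show "(\<lambda>\<omega> x. \<xi> (t + 1) x \<omega>) \<in> measurable (?N True) (Pi\<^sub>M UNIV (\<lambda>_. borel))"
      by (intro measurable_PiM_single') auto
  qed (rule space_measure_of[OF sub])
  have past: "sets (vimage_algebra (space M) (\<lambda>\<omega> (n::nat, x). Delta_vec p \<xi> (t - int n) x \<omega>) (Pi\<^sub>M UNIV (\<lambda>_. borel)))
      \<subseteq> sets (?N False)"
  proof (rule sets_image_in_sets)
    have "(\<lambda>\<omega>. Delta_vec p \<xi> (t - int n) x \<omega>) \<in> borel_measurable (?N False)" for n x
      by (rule Delta_vec_measurable) (rule meas, simp)
    then show "(\<lambda>\<omega> (n::nat, x). Delta_vec p \<xi> (t - int n) x \<omega>) \<in> measurable (?N False) (Pi\<^sub>M UNIV (\<lambda>_. borel))"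
      by (intro measurable_PiM_single') (auto simp: split_beta')
  qed (rule space_measure_of[OF sub])
  show ?thesis
    unfolding indep_set_def
    by (rule indep_sets_mono_sets[OF ind]) (use now past in \<open>auto split: bool.splits\<close>)
qed

section \<open>Law, invariance and ergodicity of the increment field\<close>

abbreviation \<nu> :: "real measure" where "\<nu> \<equiv> distr M borel (\<xi> 0 0)"

sublocale noise: iid_field \<nu>
  unfolding iid_field_def by (rule prob_space_distr) simp

lemma distr_xi: "distr M (PiM UNIV (\<lambda>_. borel)) (\<lambda>\<omega> (t, x). \<xi> t x \<omega>) = noise.field_law"
proof -
  have "distr M (PiM UNIV (\<lambda>_. borel)) (\<lambda>\<omega>. \<lambda>i\<in>UNIV. (case i of (t, x) \<Rightarrow> \<xi> t x) \<omega>)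
      = PiM UNIV (\<lambda>i. distr M borel (case i of (t, x) \<Rightarrow> \<xi> t x))"
    by (rule indep_vars_iff_distr_eq_PiM[THEN iffD1, OF _ _ xi_indep]) auto
  moreover have "distr M borel (case i of (t, x) \<Rightarrow> \<xi> t x) = \<nu>" for i :: "int \<times> (int^'d)"
    by (cases i) (simp only: prod.case, rule xi_ident)
  moreover have "(\<lambda>\<omega>. \<lambda>i\<in>UNIV. (case i of (t, x) \<Rightarrow> \<xi> t x) \<omega>) = (\<lambda>\<omega> (t, x). \<xi> t x \<omega>)"
    by (auto simp: fun_eq_iff)
  ultimately show ?thesis by simp
qed

lemma sets_field_law: "sets noise.field_law = sets (PiM UNIV (\<lambda>_. borel))"
  by (rule sets_PiM_cong) auto

abbreviation Delta_law :: "(int \<times> (int^'d) \<Rightarrow> real^'d) measure" where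
  "Delta_law \<equiv> distr M (Pi\<^sub>M UNIV (\<lambda>_. borel)) (\<lambda>\<omega> (s, y). Delta_vec p \<xi> s y \<omega>)"

text \<open>The increment field is a factor of the noise field, so properties of its shifts can be
  proved for the product measure and pushed forward.\<close>

lemma Delta_law_eq: "Delta_law = distr noise.field_law (PiM UNIV (\<lambda>_. borel)) Delta_field"
proof -
  have "(\<lambda>\<omega> (s, y). Delta_vec p \<xi> s y \<omega>) = Delta_field \<circ> (\<lambda>\<omega> (t, x). \<xi> t x \<omega>)"
    by (auto simp: fun_eq_iff Delta_field_def Delta_vec_def Delta_def Delta_partial_def)
  then have "Delta_law = distr M (PiM UNIV (\<lambda>_. borel)) (Delta_field \<circ> (\<lambda>\<omega> (t, x). \<xi> t x \<omega>))"
    by (simp only:)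
  also have "\<dots> = distr (distr M (PiM UNIV (\<lambda>_. borel)) (\<lambda>\<omega> (t, x). \<xi> t x \<omega>)) (PiM UNIV (\<lambda>_. borel)) Delta_field"
  proof (rule distr_distr[symmetric])
    show "(\<lambda>\<omega> (t, x). \<xi> t x \<omega>) \<in> measurable M (PiM UNIV (\<lambda>_. borel))"
      by (rule measurable_PiM_single') (auto simp: split_beta')
  qed (rule Delta_field_measurable[OF refl])
  finally show ?thesis by (simp only: distr_xi)
qed

lemma st_shift_measurable:
  "st_shift x t \<in> measurable (PiM UNIV (\<lambda>_. borel :: (real^'d) measure)) (PiM UNIV (\<lambda>_. borel))"
  unfolding st_shift_def by (rule measurable_PiM_single') (auto simp: split_beta')

text \<open>Equivariance moves the shift onto the noise, where it preserves the product measure. The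
  pure time shifts give stationarity of the chain.\<close>

theorem Delta_shift_invariant: "invariant_under Delta_law (st_shift x t)"
proof -
  note F = Delta_field_measurable[OF sets_field_law]
  have "distr Delta_law Delta_law (st_shift x t)
      = distr noise.field_law (PiM UNIV (\<lambda>_. borel)) (st_shift x t \<circ> Delta_field)"
    unfolding Delta_law_eq
    by (subst distr_cong[OF refl sets_distr refl]) (rule distr_distr[OF st_shift_measurable F])
  also have "st_shift x t \<circ> Delta_field = Delta_field \<circ> translate (t, x)"
    by (simp add: fun_eq_iff Delta_field_shift)
  also have "distr noise.field_law (PiM UNIV (\<lambda>_. borel)) \<dots>
      = distr (distr noise.field_law noise.field_law (translate (t, x))) (PiM UNIV (\<lambda>_. borel)) Delta_field"
    by (rule distr_distr[OF F noise.measurable_translate, symmetric])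
  also have "\<dots> = Delta_law"
    by (simp only: noise.distr_translate Delta_law_eq)
  finally show ?thesis
    using st_shift_measurable by (simp add: invariant_under_def)
qed

theorem Delta_shift_ergodic:
  assumes "(x, t) \<noteq> (0, 0)"
  shows "ergodic_under Delta_law (st_shift x t)"
  unfolding ergodic_under_def
proof (intro conjI ballI impI)
  note F = Delta_field_measurable[OF sets_field_law]
  show "st_shift x t \<in> measurable Delta_law Delta_law"
    using st_shift_measurable by simp
  fix A assume "A \<in> sets Delta_law" and inv: "st_shift x t -` A \<inter> space Delta_law = A"
  then have A: "A \<in> sets (PiM UNIV (\<lambda>_. borel))" by simp
  let ?B = "Delta_field -` A \<inter> space noise.field_law"
  have B: "?B \<in> sets noise.field_law" using F A by (rule measurable_sets)
  \<comment> \<open>The space of fields is everything, so invariance of \<open>A\<close> holds for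
    all fields and transfers to the preimage \<open>?B\<close> by pointwise equivariance.\<close>
  have "st_shift x t -` A = A" using inv by (simp add: space_PiM)
  then have fixed: "st_shift x t f \<in> A \<longleftrightarrow> f \<in> A" for f by blast
  have "translate (t, x) -` ?B \<inter> space noise.field_law = ?B"
    using Delta_field_shift noise.translate_space fixed by auto
  moreover have "(t, x) \<noteq> 0" using assms by (auto simp: zero_prod_def)
  ultimately have "measure noise.field_law ?B = 0 \<or> measure noise.field_law ?B = 1"
    by (intro noise.translate_ergodic[OF translate_orbit_inj B])
  then show "measure Delta_law A = 0 \<or> measure Delta_law A = 1"
    unfolding Delta_law_eq by (simp add: measure_distr[OF F A])
qed

end

section \<open>From the stated hypotheses to the noise field\<close>

lemma finite_range_finite_support:
  fixes p :: "int^'d \<Rightarrow> real"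
  assumes "\<exists>R::real. \<forall>x. sqrt (\<Sum>i\<in>UNIV. (real_of_int (x $ i))\<^sup>2) > R \<longrightarrow> p x = 0"
  shows "finite {x. p x \<noteq> 0}"
proof -
  obtain R where R: "\<And>x. sqrt (\<Sum>i\<in>UNIV. (real_of_int (x $ i))\<^sup>2) > R \<Longrightarrow> p x = 0"
    using assms by blast
  \<comment> \<open>Each coordinate is bounded by the Euclidean norm, so the support lies in a
    finite cube.\<close>
  have "{x. p x \<noteq> 0} \<subseteq> (\<lambda>f. \<chi> i. f i) ` (Pi\<^sub>E UNIV (\<lambda>_. {- \<lceil>R\<rceil>..\<lceil>R\<rceil>}))"
  proof
    fix x assume "x \<in> {x. p x \<noteq> 0}"
    then have le: "sqrt (\<Sum>i\<in>UNIV. (real_of_int (x $ i))\<^sup>2) \<le> R" using R[of x] by force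
    have "x $ i \<in> {- \<lceil>R\<rceil>..\<lceil>R\<rceil>}" for i
    proof -
      have "(real_of_int (x $ i))\<^sup>2 \<le> (\<Sum>i\<in>UNIV. (real_of_int (x $ i))\<^sup>2)"
        by (rule member_le_sum) auto
      then have "\<bar>real_of_int (x $ i)\<bar> \<le> sqrt (\<Sum>i\<in>UNIV. (real_of_int (x $ i))\<^sup>2)"
        by (metis real_sqrt_abs real_sqrt_le_iff)
      with le have "\<bar>real_of_int (x $ i)\<bar> \<le> R" by linarith
      then have "\<bar>x $ i\<bar> \<le> \<lceil>R\<rceil>" by linarith
      then show ?thesis by auto
    qed
    then show "x \<in> (\<lambda>f. \<chi> i. f i) ` (Pi\<^sub>E UNIV (\<lambda>_. {- \<lceil>R\<rceil>..\<lceil>R\<rceil>}))"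
      by (intro image_eqI[of _ _ "\<lambda>i. x $ i"]) auto
  qed
  then show ?thesis by (rule finite_subset) (intro finite_imageI finite_PiE; simp)
qed

theorem theorem2p2:
  fixes p :: "int^'d \<Rightarrow> real"
    and M :: "'w measure"
    and \<xi> :: "int \<Rightarrow> int^'d \<Rightarrow> 'w \<Rightarrow> real"
  assumes p_range: "\<And>x. 0 \<le> p x \<and> p x < 1"
    and p_sum: "(p has_sum 1) UNIV"
    and p_finite_range: "\<exists>R::real. \<forall>x. sqrt (\<Sum>i\<in>UNIV. (real_of_int (x $ i))\<^sup>2) > R \<longrightarrow> p x = 0"
    and p_aperiodic: "strongly_aperiodic p"
    and P: "prob_space M"
    and xi_indep: "prob_space.indep_vars M (\<lambda>_. borel) (\<lambda>(t, x). \<xi> t x) UNIV"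
    and xi_ident: "\<And>t x. distr M borel (\<xi> t x) = distr M borel (\<xi> 0 0)"
    and xi_L2: "integrable M (\<lambda>\<omega>. (\<xi> 0 0 \<omega>)\<^sup>2)"
    and xi_mean: "prob_space.expectation M (\<xi> 0 0) = 0"
  shows
    \<comment> \<open>almost sure convergence of the series\<close>
    "(AE \<omega> in M. \<forall>t x y. convergent (\<lambda>n. Delta_partial p \<xi> n t x y \<omega>))
     \<comment> \<open>L2 convergence of the series (to its almost sure limit)\<close>
     \<and> (\<forall>t x y. Delta p \<xi> t x y \<in> borel_measurable M
          \<and> integrable M (\<lambda>\<omega>. (Delta p \<xi> t x y \<omega>)\<^sup>2)
          \<and> (\<lambda>n. \<integral>\<omega>. (Delta_partial p \<xi> n t x y \<omega> - Delta p \<xi> t x y \<omega>)\<^sup>2 \<partial>M) \<longlonglongrightarrow> 0)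
     \<comment> \<open>additivity\<close>
     \<and> (AE \<omega> in M. \<forall>t x y z. Delta p \<xi> t x y \<omega> + Delta p \<xi> t y z \<omega> = Delta p \<xi> t x z \<omega>)
     \<comment> \<open>evolution equation\<close>
     \<and> (AE \<omega> in M. \<forall>t x y. Delta p \<xi> (t + 1) x y \<omega> =
          (\<Sum>\<^sub>\<infinity>z. p z * Delta p \<xi> t (x + z) (y + z) \<omega>) + \<xi> (t + 1) y \<omega> - \<xi> (t + 1) x \<omega>)
     \<comment> \<open>Markov chain recursion for Delta_t(x) = (Delta_t(x - e_i, x))_i\<close>
     \<and> (AE \<omega> in M. \<forall>t x i. Delta_vec p \<xi> (t + 1) x \<omega> $ i =
          (\<Sum>\<^sub>\<infinity>z. p z * Delta_vec p \<xi> t (x + z) \<omega> $ i) + \<xi> (t + 1) x \<omega> - \<xi> (t + 1) (x - axis i 1) \<omega>)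
     \<comment> \<open>the innovation xi_{t+1} is independent of the past (Delta_s)_{s <= t}\<close>
     \<and> (\<forall>t. prob_space.indep_set M
          (sets (vimage_algebra (space M) (\<lambda>\<omega> x. \<xi> (t + 1) x \<omega>) (Pi\<^sub>M UNIV (\<lambda>_. borel))))
          (sets (vimage_algebra (space M) (\<lambda>\<omega> (n::nat, x). Delta_vec p \<xi> (t - int n) x \<omega>) (Pi\<^sub>M UNIV (\<lambda>_. borel)))))
     \<comment> \<open>stationarity, invariance and ergodicity of the field under each nontrivial space-time shift\<close>
     \<and> (\<forall>x t. (x, t) \<noteq> (0, 0) \<longrightarrow>
          invariant_under (distr M (Pi\<^sub>M UNIV (\<lambda>_. borel)) (\<lambda>\<omega> (s, y). Delta_vec p \<xi> s y \<omega>)) (st_shift x t)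
        \<and> ergodic_under (distr M (Pi\<^sub>M UNIV (\<lambda>_. borel)) (\<lambda>\<omega> (s, y). Delta_vec p \<xi> s y \<omega>)) (st_shift x t))"
proof -
  interpret prob_space M by (rule P)
  interpret noise_field p M \<xi>
  proof
    show nonneg: "0 \<le> p x" for x using p_range by blast
    show fin: "finite {x. p x \<noteq> 0}" by (rule finite_range_finite_support[OF p_finite_range])
    show "(\<Sum>x | p x \<noteq> 0. p x) = 1"
      using infsumI[OF p_sum] infsum_eq_sum_support[OF fin, of p] by simp
  qed (use p_aperiodic xi_indep xi_ident xi_L2 xi_mean in auto)
  show ?thesis
  proof (intro conjI allI impI)
    show "AE \<omega> in M. \<forall>t x y. convergent (\<lambda>n. Delta_partial p \<xi> n t x y \<omega>)"
      by (rule AE_convergent)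
    show "AE \<omega> in M. \<forall>t x y z. Delta p \<xi> t x y \<omega> + Delta p \<xi> t y z \<omega> = Delta p \<xi> t x z \<omega>"
      using AE_convergent by (rule AE_mp) (auto intro!: Delta_additive)
    show "AE \<omega> in M. \<forall>t x y. Delta p \<xi> (t + 1) x y \<omega> =
        (\<Sum>\<^sub>\<infinity>z. p z * Delta p \<xi> t (x + z) (y + z) \<omega>) + \<xi> (t + 1) y \<omega> - \<xi> (t + 1) x \<omega>"
      using AE_convergent by (rule AE_mp) (auto intro!: Delta_evolution)
    show "AE \<omega> in M. \<forall>t x i. Delta_vec p \<xi> (t + 1) x \<omega> $ i =
        (\<Sum>\<^sub>\<infinity>z. p z * Delta_vec p \<xi> t (x + z) \<omega> $ i) + \<xi> (t + 1) x \<omega> - \<xi> (t + 1) (x - axis i 1) \<omega>"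
      using AE_convergent
    proof (rule AE_mp, intro AE_I2 impI allI)
      fix \<omega> t x and i :: 'd
      assume "\<forall>t x y. convergent (\<lambda>n. Delta_partial p \<xi> n t x y \<omega>)"
      then show "Delta_vec p \<xi> (t + 1) x \<omega> $ i =
          (\<Sum>\<^sub>\<infinity>z. p z * Delta_vec p \<xi> t (x + z) \<omega> $ i) + \<xi> (t + 1) x \<omega> - \<xi> (t + 1) (x - axis i 1) \<omega>"
        \<comment> \<open>Translation by \<open>z\<close> preserves neighbouring pairs:
          \<open>(x - axis i 1) + z\<close> equals \<open>(x + z) - axis i 1\<close>.\<close>
        using Delta_evolution[of \<xi> \<omega> t "x - axis i 1" x] by (simp add: Delta_vec_def diff_add_eq)
    qed
  qed (fact Delta_random_variable Delta_square_integrable Delta_L2_limit innovation_indep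
    | rule Delta_shift_invariant | erule Delta_shift_ergodic)+
qed

end
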